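(* Let $S$ be a commutative Noetherian local ring, let $g\in S$, and let $R=S\llbracket z\rrbracket/(z^2+g)$. Let $\varphi$ be an $n\times n$ matrix over $S\llbracket z\rrbracket$ whose entries lie in $S$ such that $(z\,\mathrm{Id}_n-\varphi,\ z\,\mathrm{Id}_n+\varphi)$ is a matrix factorization for $z^2+g$ in $S\llbracket z\rrbracket$. Let $M=\operatorname{coker}(\overline{z\,\mathrm{Id}_n-\varphi})$. Then $$\operatorname{im}\bigl(\operatorname{Hom}_R(M,R)\hookrightarrow \operatorname{Hom}_R(R^n,R)\xrightarrow{\ \cong\ }R^n\bigr)=\operatorname{im}(\overline{z\,\mathrm{Id}_n+\varphi^{\intercal}}),$$ where the first map is induced by the canonical surjection $R^n\to M$ and the second map is the isomorphism sending $f:R^n\to R$ to the vector $(f(e_1),\ldots,f(e_n))^{\intercal}$, with $e_1,\ldots,e_n$ the standard basis of $R^n$.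
   Context: A matrix factorization for an element $x$ of a ring $A$ is a pair of maps of free $A$-modules $(\alpha:F\to G,\ \beta:G\to F)$ such that $\alpha\beta=x\cdot 1_G$ and $\beta\alpha=x\cdot 1_F$. An $n\times n$ matrix is regarded as a linear map between free modules of rank $n$. For a matrix $\Phi$ over $S\llbracket z\rrbracket$, $\overline{\Phi}$ denotes the same matrix over the quotient ring $R=S\llbracket z\rrbracket/(z^2+g)$. $\mathrm{Id}_n$ is the $n\times n$ identity matrix and $\varphi^{\intercal}$ is the transpose of $\varphi$. *)

theory Defs
  imports "HOL-Algebra.QuotRing" "HOL-Algebra.Module" "HOL-Algebra.Ring_Divisibility"
begin

section \<open>Rings\<close>

definition local_ring :: "('a, 'b) ring_scheme \<Rightarrow> bool" where
  "local_ring S \<longleftrightarrow> cring S \<and> (\<exists>!\<mm>. maximalideal \<mm> S)"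

text \<open>The ring of formal power series in one variable \<open>z\<close> over a ring with carrier; a series is its
  sequence of coefficients.\<close>

definition ps_ring :: "('a, 'b) ring_scheme \<Rightarrow> (nat \<Rightarrow> 'a) ring" where
  "ps_ring S =
    \<lparr>carrier = UNIV \<rightarrow> carrier S,
     monoid.mult = (\<lambda>p q k. \<Oplus>\<^bsub>S\<^esub>i\<in>{..k}. p i \<otimes>\<^bsub>S\<^esub> q (k - i)),
     one = (\<lambda>k. if k = 0 then \<one>\<^bsub>S\<^esub> else \<zero>\<^bsub>S\<^esub>),
     ring.zero = (\<lambda>k. \<zero>\<^bsub>S\<^esub>),
     add = (\<lambda>p q k. p k \<oplus>\<^bsub>S\<^esub> q k)\<rparr>"

definition ps_const :: "('a, 'b) ring_scheme \<Rightarrow> 'a \<Rightarrow> (nat \<Rightarrow> 'a)" where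
  "ps_const S a = (\<lambda>k. if k = 0 then a else \<zero>\<^bsub>S\<^esub>)"

definition ps_z :: "('a, 'b) ring_scheme \<Rightarrow> (nat \<Rightarrow> 'a)" where
  "ps_z S = (\<lambda>k. if k = 1 then \<one>\<^bsub>S\<^esub> else \<zero>\<^bsub>S\<^esub>)"

section \<open>Modules\<close>

text \<open>Homomorphisms are extensional functions on the carrier of the source, so that equality of
  homomorphisms is equality of functions.\<close>

definition mod_hom ::
  "('a, 'k) ring_scheme \<Rightarrow> ('a, 'b, 'm) module_scheme \<Rightarrow> ('a, 'c, 'n) module_scheme \<Rightarrow> ('b \<Rightarrow> 'c) set"
  where
  "mod_hom A M N =
    {f \<in> carrier M \<rightarrow>\<^sub>E carrier N.
      (\<forall>x\<in>carrier M. \<forall>y\<in>carrier M. f (x \<oplus>\<^bsub>M\<^esub> y) = f x \<oplus>\<^bsub>N\<^esub> f y) \<and>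
      (\<forall>a\<in>carrier A. \<forall>x\<in>carrier M. f (a \<odot>\<^bsub>M\<^esub> x) = a \<odot>\<^bsub>N\<^esub> f x)}"

definition self_module :: "('a, 'k) ring_scheme \<Rightarrow> ('a, 'a) module" where
  "self_module A =
    \<lparr>carrier = carrier A, monoid.mult = monoid.mult A, one = monoid.one A,
     ring.zero = ring.zero A, add = add A, smult = monoid.mult A\<rparr>"

text \<open>The module \<open>A\<^sup>n\<close>; coordinates are indexed by \<open>0, \<dots>, n - 1\<close>. The fields \<open>mult\<close> and \<open>one\<close> of the
  record play no role for modules.\<close>

definition power_module :: "('a, 'k) ring_scheme \<Rightarrow> nat \<Rightarrow> ('a, nat \<Rightarrow> 'a) module" where
  "power_module A n =
    \<lparr>carrier = {..<n} \<rightarrow>\<^sub>E carrier A, monoid.mult = undefined, one = undefined,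
     ring.zero = (\<lambda>i\<in>{..<n}. \<zero>\<^bsub>A\<^esub>),
     add = (\<lambda>v w. \<lambda>i\<in>{..<n}. v i \<oplus>\<^bsub>A\<^esub> w i),
     smult = (\<lambda>a v. \<lambda>i\<in>{..<n}. a \<otimes>\<^bsub>A\<^esub> v i)\<rparr>"

definition std_basis :: "('a, 'k) ring_scheme \<Rightarrow> nat \<Rightarrow> nat \<Rightarrow> (nat \<Rightarrow> 'a)" where
  "std_basis A n i = (\<lambda>k\<in>{..<n}. if k = i then \<one>\<^bsub>A\<^esub> else \<zero>\<^bsub>A\<^esub>)"

text \<open>A module is free if it has a basis \<open>B\<close>: every element is, for a unique family of coefficients
  with finite support, the corresponding linear combination of elements of \<open>B\<close>. No finiteness of \<open>B\<close>
  is required.\<close>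

definition free_module :: "('a, 'k) ring_scheme \<Rightarrow> ('a, 'b, 'm) module_scheme \<Rightarrow> bool" where
  "free_module A F \<longleftrightarrow> module A F \<and>
    (\<exists>B\<subseteq>carrier F. \<forall>x\<in>carrier F.
      \<exists>!c. c \<in> B \<rightarrow>\<^sub>E carrier A \<and> finite {b\<in>B. c b \<noteq> \<zero>\<^bsub>A\<^esub>} \<and>
           x = (\<Oplus>\<^bsub>F\<^esub>b\<in>{b\<in>B. c b \<noteq> \<zero>\<^bsub>A\<^esub>}. c b \<odot>\<^bsub>F\<^esub> b))"

definition quotient_module :: "('a, 'b, 'm) module_scheme \<Rightarrow> 'b set \<Rightarrow> ('a, 'b set) module" where
  "quotient_module N U =
    \<lparr>carrier = a_rcosets\<^bsub>N\<^esub> U, monoid.mult = undefined, one = undefined,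
     ring.zero = U, add = set_add N,
     smult = (\<lambda>a X. \<Union>x\<in>X. U +>\<^bsub>N\<^esub> (a \<odot>\<^bsub>N\<^esub> x))\<rparr>"

definition quotient_proj :: "('a, 'b, 'm) module_scheme \<Rightarrow> 'b set \<Rightarrow> 'b \<Rightarrow> 'b set" where
  "quotient_proj N U = (\<lambda>x\<in>carrier N. U +>\<^bsub>N\<^esub> x)"

definition coker ::
  "('a, 'b, 'm) module_scheme \<Rightarrow> ('a, 'c, 'n) module_scheme \<Rightarrow> ('b \<Rightarrow> 'c) \<Rightarrow> ('a, 'c set) module" where
  "coker M N f = quotient_module N (f ` carrier M)"

definition coker_proj ::
  "('a, 'b, 'm) module_scheme \<Rightarrow> ('a, 'c, 'n) module_scheme \<Rightarrow> ('b \<Rightarrow> 'c) \<Rightarrow> 'c \<Rightarrow> 'c set" where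
  "coker_proj M N f = quotient_proj N (f ` carrier M)"

text \<open>The map \<open>Hom(N, L) \<rightarrow> Hom(M, L)\<close> induced by \<open>h : M \<rightarrow> N\<close>.\<close>

definition hom_precomp :: "('a, 'b, 'm) module_scheme \<Rightarrow> ('b \<Rightarrow> 'c) \<Rightarrow> ('c \<Rightarrow> 'd) \<Rightarrow> ('b \<Rightarrow> 'd)" where
  "hom_precomp M h = (\<lambda>f. compose (carrier M) f h)"

text \<open>The isomorphism \<open>Hom(A\<^sup>n, A) \<rightarrow> A\<^sup>n\<close> sending \<open>f\<close> to its values on the standard basis.\<close>

definition dual_coords :: "('a, 'k) ring_scheme \<Rightarrow> nat \<Rightarrow> ((nat \<Rightarrow> 'a) \<Rightarrow> 'a) \<Rightarrow> (nat \<Rightarrow> 'a)" where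
  "dual_coords A n f = (\<lambda>i\<in>{..<n}. f (std_basis A n i))"

section \<open>Matrices\<close>

text \<open>An \<open>n \<times> n\<close> matrix is a function of a row and a column index; only its values at indices below
  \<open>n\<close> matter.\<close>

type_synonym 'a sqmat = "nat \<Rightarrow> nat \<Rightarrow> 'a"

definition mat_id :: "('a, 'k) ring_scheme \<Rightarrow> 'a sqmat" where
  "mat_id A = (\<lambda>i j. if i = j then \<one>\<^bsub>A\<^esub> else \<zero>\<^bsub>A\<^esub>)"

definition mat_scale :: "('a, 'k) ring_scheme \<Rightarrow> 'a \<Rightarrow> 'a sqmat \<Rightarrow> 'a sqmat" where
  "mat_scale A a \<Phi> = (\<lambda>i j. a \<otimes>\<^bsub>A\<^esub> \<Phi> i j)"

definition mat_add :: "('a, 'k) ring_scheme \<Rightarrow> 'a sqmat \<Rightarrow> 'a sqmat \<Rightarrow> 'a sqmat" where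
  "mat_add A \<Phi> \<Psi> = (\<lambda>i j. \<Phi> i j \<oplus>\<^bsub>A\<^esub> \<Psi> i j)"

definition mat_diff :: "('a, 'k) ring_scheme \<Rightarrow> 'a sqmat \<Rightarrow> 'a sqmat \<Rightarrow> 'a sqmat" where
  "mat_diff A \<Phi> \<Psi> = (\<lambda>i j. \<Phi> i j \<ominus>\<^bsub>A\<^esub> \<Psi> i j)"

definition mat_transpose :: "'a sqmat \<Rightarrow> 'a sqmat" where
  "mat_transpose \<Phi> = (\<lambda>i j. \<Phi> j i)"

definition mat_bar :: "('a, 'k) ring_scheme \<Rightarrow> 'a set \<Rightarrow> 'a sqmat \<Rightarrow> 'a set sqmat" where
  "mat_bar A I \<Phi> = (\<lambda>i j. I +>\<^bsub>A\<^esub> \<Phi> i j)"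

text \<open>The linear map \<open>A\<^sup>n \<rightarrow> A\<^sup>n\<close> of a matrix, acting on column vectors.\<close>

definition mat_map :: "('a, 'k) ring_scheme \<Rightarrow> nat \<Rightarrow> 'a sqmat \<Rightarrow> (nat \<Rightarrow> 'a) \<Rightarrow> (nat \<Rightarrow> 'a)" where
  "mat_map A n \<Phi> =
    (\<lambda>v\<in>carrier (power_module A n). \<lambda>i\<in>{..<n}. \<Oplus>\<^bsub>A\<^esub>j\<in>{..<n}. \<Phi> i j \<otimes>\<^bsub>A\<^esub> v j)"

section \<open>Matrix factorizations\<close>

definition matrix_factorization ::
  "('a, 'k) ring_scheme \<Rightarrow> 'a \<Rightarrow> ('a, 'b, 'm) module_scheme \<Rightarrow> ('a, 'c, 'n) module_scheme
    \<Rightarrow> ('b \<Rightarrow> 'c) \<Rightarrow> ('c \<Rightarrow> 'b) \<Rightarrow> bool" where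
  "matrix_factorization A x F G \<alpha> \<beta> \<longleftrightarrow>
    free_module A F \<and> free_module A G \<and> \<alpha> \<in> mod_hom A F G \<and> \<beta> \<in> mod_hom A G F \<and>
    (\<forall>y\<in>carrier G. \<alpha> (\<beta> y) = x \<odot>\<^bsub>G\<^esub> y) \<and> (\<forall>y\<in>carrier F. \<beta> (\<alpha> y) = x \<odot>\<^bsub>F\<^esub> y)"

section \<open>Basic facts\<close>

text \<open>The objects above are what their names say: in particular, power series form a commutative
  ring, the modules \<open>A\<^sup>n\<close> are free, matrices act by homomorphisms, and quotients are modules.\<close>

lemma ps_simps [simp]:
  "p \<in> carrier (ps_ring S) \<longleftrightarrow> p \<in> UNIV \<rightarrow> carrier S"
  "(p \<otimes>\<^bsub>ps_ring S\<^esub> q) k = (\<Oplus>\<^bsub>S\<^esub>i\<in>{..k}. p i \<otimes>\<^bsub>S\<^esub> q (k - i))"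
  "(p \<oplus>\<^bsub>ps_ring S\<^esub> q) k = p k \<oplus>\<^bsub>S\<^esub> q k"
  "\<one>\<^bsub>ps_ring S\<^esub> k = (if k = 0 then \<one>\<^bsub>S\<^esub> else \<zero>\<^bsub>S\<^esub>)"
  "\<zero>\<^bsub>ps_ring S\<^esub> k = \<zero>\<^bsub>S\<^esub>"
  by (simp_all add: ps_ring_def)

lemma (in cring) ps_mult_assoc:
  assumes "p \<in> UNIV \<rightarrow> carrier R" "q \<in> UNIV \<rightarrow> carrier R" "r \<in> UNIV \<rightarrow> carrier R"
  shows "(p \<otimes>\<^bsub>ps_ring R\<^esub> q) \<otimes>\<^bsub>ps_ring R\<^esub> r = p \<otimes>\<^bsub>ps_ring R\<^esub> (q \<otimes>\<^bsub>ps_ring R\<^esub> r)"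
proof
  fix n
  {
    fix k and a b c :: "nat \<Rightarrow> 'a"
    assume R: "a \<in> UNIV \<rightarrow> carrier R" "b \<in> UNIV \<rightarrow> carrier R" "c \<in> UNIV \<rightarrow> carrier R"
    then have "k <= n \<Longrightarrow>
      (\<Oplus>j \<in> {..k}. (\<Oplus>i \<in> {..j}. a i \<otimes> b (j-i)) \<otimes> c (n-j)) =
      (\<Oplus>j \<in> {..k}. a j \<otimes> (\<Oplus>i \<in> {..k-j}. b i \<otimes> c (n-j-i)))"
      (is "_ \<Longrightarrow> ?eq k")
    proof (induct k)
      case 0 then show ?case by (simp add: Pi_def m_assoc)
    next
      case (Suc k)
      then have "k <= n" by arith
      from this R have "?eq k" by (rule Suc)
      with R show ?case
        by (simp cong: finsum_cong
             add: Suc_diff_le Pi_def l_distr r_distr m_assoc)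
           (simp cong: finsum_cong add: Pi_def a_ac finsum_ldistr m_assoc)
    qed
  }
  with assms show "((p \<otimes>\<^bsub>ps_ring R\<^esub> q) \<otimes>\<^bsub>ps_ring R\<^esub> r) n = (p \<otimes>\<^bsub>ps_ring R\<^esub> (q \<otimes>\<^bsub>ps_ring R\<^esub> r)) n"
    by (simp add: Pi_def)
qed

lemma (in cring) ps_mult_comm:
  assumes "p \<in> UNIV \<rightarrow> carrier R" "q \<in> UNIV \<rightarrow> carrier R"
  shows "p \<otimes>\<^bsub>ps_ring R\<^esub> q = q \<otimes>\<^bsub>ps_ring R\<^esub> p"
proof
  fix n
  have l: "(\<Oplus>i \<in> {..k}. a i \<otimes> b (n-i)) = (\<Oplus>i \<in> {..k}. a (k-i) \<otimes> b (i+n-k))"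
    if "a \<in> UNIV \<rightarrow> carrier R" "b \<in> UNIV \<rightarrow> carrier R" and "k <= n"
    for k and a b :: "nat\<Rightarrow>'a"
  using that
  proof (induct k)
    case 0 then show ?case by (simp add: Pi_def)
  next
    case (Suc k) then show ?case
      by (subst (2) finsum_Suc2) (simp add: Pi_def a_comm)+
  qed
  from assms l[of p q n] show "(p \<otimes>\<^bsub>ps_ring R\<^esub> q) n = (q \<otimes>\<^bsub>ps_ring R\<^esub> p) n"
    by (simp add: Pi_def m_comm)
qed

lemma (in cring) ps_one_mult:
  assumes "p \<in> UNIV \<rightarrow> carrier R"
  shows "\<one>\<^bsub>ps_ring R\<^esub> \<otimes>\<^bsub>ps_ring R\<^esub> p = p"
proof
  fix n
  from assms show "(\<one>\<^bsub>ps_ring R\<^esub> \<otimes>\<^bsub>ps_ring R\<^esub> p) n = p n"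
    by (cases n) (simp_all del: finsum_Suc add: finsum_Suc2 Pi_def)
qed

lemma (in cring) ps_cring: "cring (ps_ring R)"
proof (rule cringI)
  show "abelian_group (ps_ring R)"
  proof (rule abelian_groupI)
    fix p assume p: "p \<in> carrier (ps_ring R)"
    show "\<exists>q\<in>carrier (ps_ring R). q \<oplus>\<^bsub>ps_ring R\<^esub> p = \<zero>\<^bsub>ps_ring R\<^esub>"
      using p by (intro bexI[of _ "\<lambda>k. \<ominus> p k"] ext) (auto simp: Pi_def l_neg)
  qed (auto simp: fun_eq_iff Pi_def a_ac)
  show "comm_monoid (ps_ring R)"
    by (rule comm_monoidI) (auto simp: ps_mult_assoc ps_one_mult intro: ps_mult_comm, auto simp: Pi_def)
  show "(p \<oplus>\<^bsub>ps_ring R\<^esub> q) \<otimes>\<^bsub>ps_ring R\<^esub> r =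
      p \<otimes>\<^bsub>ps_ring R\<^esub> r \<oplus>\<^bsub>ps_ring R\<^esub> q \<otimes>\<^bsub>ps_ring R\<^esub> r"
    if "p \<in> carrier (ps_ring R)" "q \<in> carrier (ps_ring R)" "r \<in> carrier (ps_ring R)" for p q r
    using that by (auto simp: fun_eq_iff Pi_def l_distr finsum_addf)
qed

lemma power_module_simps [simp]:
  "carrier (power_module A n) = {..<n} \<rightarrow>\<^sub>E carrier A"
  "\<zero>\<^bsub>power_module A n\<^esub> = (\<lambda>i\<in>{..<n}. \<zero>\<^bsub>A\<^esub>)"
  "v \<oplus>\<^bsub>power_module A n\<^esub> w = (\<lambda>i\<in>{..<n}. v i \<oplus>\<^bsub>A\<^esub> w i)"
  "a \<odot>\<^bsub>power_module A n\<^esub> v = (\<lambda>i\<in>{..<n}. a \<otimes>\<^bsub>A\<^esub> v i)"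
  by (simp_all add: power_module_def)

lemma self_module_simps [simp]:
  "carrier (self_module A) = carrier A"
  "\<zero>\<^bsub>self_module A\<^esub> = \<zero>\<^bsub>A\<^esub>"
  "a \<oplus>\<^bsub>self_module A\<^esub> b = a \<oplus>\<^bsub>A\<^esub> b"
  "a \<odot>\<^bsub>self_module A\<^esub> b = a \<otimes>\<^bsub>A\<^esub> b"
  by (simp_all add: self_module_def)

lemma (in cring) power_module: "module R (power_module R n)"
proof (rule moduleI)
  show "abelian_group (power_module R n)"
  proof (rule abelian_groupI)
    fix p assume p: "p \<in> carrier (power_module R n)"
    show "\<exists>q\<in>carrier (power_module R n). q \<oplus>\<^bsub>power_module R n\<^esub> p = \<zero>\<^bsub>power_module R n\<^esub>"
      using p by (intro bexI[of _ "\<lambda>k\<in>{..<n}. \<ominus> p k"] ext) (auto simp: PiE_def Pi_def l_neg)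
  qed (auto simp: fun_eq_iff PiE_def Pi_def a_ac extensional_def restrict_def)
qed (auto simp: fun_eq_iff PiE_def Pi_def l_distr r_distr m_assoc extensional_def restrict_def is_cring)

lemma (in cring) self_module: "module R (self_module R)"
proof (rule moduleI)
  show "abelian_group (self_module R)"
    by (rule abelian_groupI) (auto simp: a_ac intro: l_neg bexI[of _ "\<ominus> _"])
qed (auto simp: l_distr r_distr m_assoc is_cring)

lemma (in cring) power_module_finsum:
  assumes "finite X" "\<And>x. x \<in> X \<Longrightarrow> f x \<in> carrier (power_module R n)" "i < n"
  shows "(\<Oplus>\<^bsub>power_module R n\<^esub>x\<in>X. f x) i = (\<Oplus>x\<in>X. f x i)"
proof -
  interpret N: module R "power_module R n" by (rule power_module)
  show ?thesis using assms(1,2)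
  proof (induction X rule: finite_induct)
    case empty
    then show ?case using assms(3) by simp
  next
    case (insert x X)
    then have "f \<in> X \<rightarrow> carrier (power_module R n)" "f x \<in> carrier (power_module R n)" by auto
    moreover have "(\<lambda>x. f x i) \<in> X \<rightarrow> carrier R" "f x i \<in> carrier R"
      using insert.prems assms(3) by (auto simp: PiE_def Pi_def)
    ultimately show ?case using insert assms(3)
      by (simp add: N.finsum_insert finsum_insert del: power_module_simps(1))
  qed
qed

lemma (in cring) std_basis_closed [simp]: "std_basis R n i \<in> carrier (power_module R n)"
  by (auto simp: std_basis_def)

lemma (in cring) finsum_delta:
  assumes "finite X" "\<And>j. j \<in> X \<Longrightarrow> f j \<in> carrier R"
  shows "(\<Oplus>j\<in>X. f j \<otimes> (if i = j then \<one> else \<zero>)) = (if i \<in> X then f i else \<zero>)"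
proof -
  have "(\<Oplus>j\<in>X. f j \<otimes> (if i = j then \<one> else \<zero>)) = (\<Oplus>j\<in>X. if i = j then f j else \<zero>)"
    by (rule finsum_cong') (use assms in auto)
  also have "\<dots> = (if i \<in> X then f i else \<zero>)"
  proof (cases "i \<in> X")
    case True then show ?thesis using finsum_singleton[of i X f] assms by auto
  next
    case False
    then have "(\<Oplus>j\<in>X. if i = j then f j else \<zero>) = (\<Oplus>j\<in>X. \<zero>)"
      by (intro finsum_cong') auto
    with False show ?thesis by simp
  qed
  finally show ?thesis .
qed

lemma (in cring) std_basis_expansion:
  assumes "X \<subseteq> {..<n}" "\<And>j. j \<in> X \<Longrightarrow> c j \<in> carrier R" "i < n"
  shows "(\<Oplus>\<^bsub>power_module R n\<^esub>j\<in>X. c j \<odot>\<^bsub>power_module R n\<^esub> std_basis R n j) i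
       = (if i \<in> X then c i else \<zero>)"
proof -
  have fin: "finite X" using assms(1) finite_subset by blast
  have "(\<Oplus>\<^bsub>power_module R n\<^esub>j\<in>X. c j \<odot>\<^bsub>power_module R n\<^esub> std_basis R n j) i
      = (\<Oplus>j\<in>X. (c j \<odot>\<^bsub>power_module R n\<^esub> std_basis R n j) i)"
    using fin assms by (intro power_module_finsum) (auto simp: std_basis_def)
  also have "\<dots> = (\<Oplus>j\<in>X. c j \<otimes> (if i = j then \<one> else \<zero>))"
    using assms by (intro finsum_cong') (auto simp: std_basis_def)
  also have "\<dots> = (if i \<in> X then c i else \<zero>)"
    using finsum_delta[OF fin, of c i] assms by auto
  finally show ?thesis .
qed

lemma (in cring) free_power_module:
  assumes nontriv: "\<one> \<noteq> \<zero>"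
  shows "free_module R (power_module R n)"
proof -
  let ?F = "power_module R n" and ?e = "std_basis R n"
  let ?B = "?e ` {..<n}"
  interpret N: module R ?F by (rule power_module)
  have inj: "inj_on ?e {..<n}"
  proof (rule inj_onI)
    fix i j assume ij: "i \<in> {..<n}" "j \<in> {..<n}" and eq: "?e i = ?e j"
    then have "?e i i = ?e j i" by simp
    then show "i = j" using ij nontriv by (auto simp: std_basis_def split: if_splits)
  qed
  have comb: "(\<Oplus>\<^bsub>?F\<^esub>b\<in>{b\<in>?B. c b \<noteq> \<zero>}. c b \<odot>\<^bsub>?F\<^esub> b) = (\<lambda>i\<in>{..<n}. c (?e i))"
    if c: "c \<in> ?B \<rightarrow>\<^sub>E carrier R" for c
  proof -
    let ?X = "{j\<in>{..<n}. c (?e j) \<noteq> \<zero>}"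
    have cX: "c (?e j) \<in> carrier R" if "j < n" for j using c that by auto
    have set: "{b\<in>?B. c b \<noteq> \<zero>} = ?e ` ?X" by auto
    have cl: "c (?e j) \<odot>\<^bsub>?F\<^esub> ?e j \<in> carrier ?F" if "j < n" for j
      by (rule N.smult_closed[OF cX[OF that] std_basis_closed])
    have "(\<Oplus>\<^bsub>?F\<^esub>b\<in>{b\<in>?B. c b \<noteq> \<zero>}. c b \<odot>\<^bsub>?F\<^esub> b)
        = (\<Oplus>\<^bsub>?F\<^esub>j\<in>?X. c (?e j) \<odot>\<^bsub>?F\<^esub> ?e j)"
      unfolding set by (rule N.finsum_reindex) (use cl inj in \<open>auto intro: inj_on_subset simp del: power_module_simps\<close>)
    moreover have "(\<Oplus>\<^bsub>?F\<^esub>j\<in>?X. c (?e j) \<odot>\<^bsub>?F\<^esub> ?e j) = (\<lambda>i\<in>{..<n}. c (?e i))"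
    proof (rule extensionalityI[of _ "{..<n}"])
      have "(\<Oplus>\<^bsub>?F\<^esub>j\<in>?X. c (?e j) \<odot>\<^bsub>?F\<^esub> ?e j) \<in> carrier ?F"
        by (rule N.finsum_closed) (use cl in \<open>auto simp del: power_module_simps\<close>)
      then show "(\<Oplus>\<^bsub>?F\<^esub>j\<in>?X. c (?e j) \<odot>\<^bsub>?F\<^esub> ?e j) \<in> extensional {..<n}"
        by (simp add: PiE_def)
    next
      fix i assume "i \<in> {..<n}"
      then have "(\<Oplus>\<^bsub>?F\<^esub>j\<in>?X. c (?e j) \<odot>\<^bsub>?F\<^esub> ?e j) i = (if i \<in> ?X then c (?e i) else \<zero>)"
        by (intro std_basis_expansion) (use cX in auto)
      also have "\<dots> = (\<lambda>i\<in>{..<n}. c (?e i)) i" using \<open>i \<in> {..<n}\<close> by simp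
      finally show "(\<Oplus>\<^bsub>?F\<^esub>j\<in>?X. c (?e j) \<odot>\<^bsub>?F\<^esub> ?e j) i = (\<lambda>i\<in>{..<n}. c (?e i)) i" .
    qed simp
    ultimately show ?thesis by simp
  qed
  have "\<exists>!c. c \<in> ?B \<rightarrow>\<^sub>E carrier R \<and> finite {b\<in>?B. c b \<noteq> \<zero>} \<and>
           x = (\<Oplus>\<^bsub>?F\<^esub>b\<in>{b\<in>?B. c b \<noteq> \<zero>}. c b \<odot>\<^bsub>?F\<^esub> b)" if x: "x \<in> carrier ?F" for x
  proof
    let ?c = "\<lambda>b\<in>?B. x (the_inv_into {..<n} ?e b)"
    have ce: "?c (?e i) = x i" if "i < n" for i
      using inj that by (simp add: the_inv_into_f_f)
    have c: "?c \<in> ?B \<rightarrow>\<^sub>E carrier R"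
    proof (rule PiE_I)
      fix b assume "b \<in> ?B"
      then obtain i where i: "i < n" "b = ?e i" by auto
      have "x i \<in> carrier R" using x i(1) by auto
      then show "?c b \<in> carrier R" unfolding i(2) ce[OF i(1)] .
    qed simp
    moreover have "(\<lambda>i\<in>{..<n}. ?c (?e i)) = x"
    proof (rule extensionalityI[of _ "{..<n}"])
      show "(\<lambda>i\<in>{..<n}. ?c (?e i)) i = x i" if "i \<in> {..<n}" for i
        using ce that by simp
    qed (use x in \<open>auto simp: PiE_def\<close>)
    ultimately show "?c \<in> ?B \<rightarrow>\<^sub>E carrier R \<and> finite {b\<in>?B. ?c b \<noteq> \<zero>} \<and>
           x = (\<Oplus>\<^bsub>?F\<^esub>b\<in>{b\<in>?B. ?c b \<noteq> \<zero>}. ?c b \<odot>\<^bsub>?F\<^esub> b)"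
      unfolding comb[OF c] by (intro conjI) (assumption, simp_all)
    fix c assume A: "c \<in> ?B \<rightarrow>\<^sub>E carrier R \<and> finite {b\<in>?B. c b \<noteq> \<zero>} \<and>
           x = (\<Oplus>\<^bsub>?F\<^esub>b\<in>{b\<in>?B. c b \<noteq> \<zero>}. c b \<odot>\<^bsub>?F\<^esub> b)"
    then have xc: "x = (\<lambda>i\<in>{..<n}. c (?e i))" using comb by simp
    show "c = ?c"
    proof (rule extensionalityI[of _ ?B])
      fix b assume "b \<in> ?B"
      then obtain i where i: "i < n" "b = ?e i" by auto
      have "c (?e i) = x i" using xc i(1) by simp
      then show "c b = ?c b" unfolding i(2) ce[OF i(1)] .
    qed (use A in \<open>auto simp: PiE_def\<close>)
  qed
  then show ?thesis unfolding free_module_def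
    by (intro conjI power_module exI[of _ ?B]) (auto simp del: power_module_simps)
qed

lemma (in cring) mat_map_hom:
  assumes "\<And>i j. i < n \<Longrightarrow> j < n \<Longrightarrow> \<Phi> i j \<in> carrier R"
  shows "mat_map R n \<Phi> \<in> mod_hom R (power_module R n) (power_module R n)"
proof -
  interpret N: module R "power_module R n" by (rule power_module)
  have 1: "(\<Oplus>j\<in>{..<n}. \<Phi> i j \<otimes> (v j \<oplus> w j)) =
      (\<Oplus>j\<in>{..<n}. \<Phi> i j \<otimes> v j) \<oplus> (\<Oplus>j\<in>{..<n}. \<Phi> i j \<otimes> w j)"
    if "i < n" "v \<in> {..<n} \<rightarrow>\<^sub>E carrier R" "w \<in> {..<n} \<rightarrow>\<^sub>E carrier R" for i v w
  proof -
    have "(\<Oplus>j\<in>{..<n}. \<Phi> i j \<otimes> (v j \<oplus> w j)) = (\<Oplus>j\<in>{..<n}. \<Phi> i j \<otimes> v j \<oplus> \<Phi> i j \<otimes> w j)"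
      using that assms by (intro finsum_cong') (auto simp: PiE_def Pi_def r_distr)
    also have "\<dots> = (\<Oplus>j\<in>{..<n}. \<Phi> i j \<otimes> v j) \<oplus> (\<Oplus>j\<in>{..<n}. \<Phi> i j \<otimes> w j)"
      using that assms by (intro finsum_addf) (auto simp: PiE_def Pi_def)
    finally show ?thesis .
  qed
  have 2: "(\<Oplus>j\<in>{..<n}. \<Phi> i j \<otimes> (a \<otimes> v j)) = a \<otimes> (\<Oplus>j\<in>{..<n}. \<Phi> i j \<otimes> v j)"
    if "i < n" "v \<in> {..<n} \<rightarrow>\<^sub>E carrier R" "a \<in> carrier R" for i a v
  proof -
    have "a \<otimes> (\<Oplus>j\<in>{..<n}. \<Phi> i j \<otimes> v j) = (\<Oplus>j\<in>{..<n}. a \<otimes> (\<Phi> i j \<otimes> v j))"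
      using that assms by (intro finsum_rdistr) (auto simp: PiE_def Pi_def)
    also have "\<dots> = (\<Oplus>j\<in>{..<n}. \<Phi> i j \<otimes> (a \<otimes> v j))"
      using that assms by (intro finsum_cong') (auto simp: PiE_def Pi_def m_lcomm)
    finally show ?thesis by simp
  qed
  have 3: "(\<Oplus>j\<in>{..<n}. \<Phi> i j \<otimes> v j) \<in> carrier R" 
    if "i < n" "v \<in> {..<n} \<rightarrow>\<^sub>E carrier R" for i v
    using that assms by (intro finsum_closed) (auto simp: PiE_def Pi_def)
  let ?f = "\<lambda>v. \<lambda>i\<in>{..<n}. \<Oplus>j\<in>{..<n}. \<Phi> i j \<otimes> v j"
  have f: "mat_map R n \<Phi> v = ?f v" if "v \<in> carrier (power_module R n)" for v
    using that by (simp add: mat_map_def)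
  have r: "(\<Oplus>j\<in>{..<n}. \<Phi> i j \<otimes> restrict u {..<n} j) = (\<Oplus>j\<in>{..<n}. \<Phi> i j \<otimes> u j)"
    if "i < n" "\<And>j. j < n \<Longrightarrow> u j \<in> carrier R" for i u
    using that assms by (intro finsum_cong') auto
  show ?thesis
    unfolding mod_hom_def
  proof (intro CollectI conjI ballI)
    show "mat_map R n \<Phi> \<in> carrier (power_module R n) \<rightarrow>\<^sub>E carrier (power_module R n)"
      using 3 by (auto simp: mat_map_def)
    fix v assume v: "v \<in> carrier (power_module R n)"
    show "mat_map R n \<Phi> (v \<oplus>\<^bsub>power_module R n\<^esub> w)
        = mat_map R n \<Phi> v \<oplus>\<^bsub>power_module R n\<^esub> mat_map R n \<Phi> w"
      if w: "w \<in> carrier (power_module R n)" for w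
    proof -
      have "mat_map R n \<Phi> (v \<oplus>\<^bsub>power_module R n\<^esub> w) = ?f (v \<oplus>\<^bsub>power_module R n\<^esub> w)"
        using v w by (intro f N.a_closed)
      also have "\<dots> = (\<lambda>i\<in>{..<n}. (\<Oplus>j\<in>{..<n}. \<Phi> i j \<otimes> (v j \<oplus> w j)))"
      proof (rule restrict_ext)
        fix i assume "i \<in> {..<n}"
        then show "(\<Oplus>j\<in>{..<n}. \<Phi> i j \<otimes> (v \<oplus>\<^bsub>power_module R n\<^esub> w) j)
            = (\<Oplus>j\<in>{..<n}. \<Phi> i j \<otimes> (v j \<oplus> w j))"
          using r[of i "\<lambda>j. v j \<oplus> w j"] v w by (auto simp: PiE_def Pi_def simp del: restrict_apply)
      qed
      also have "\<dots> = mat_map R n \<Phi> v \<oplus>\<^bsub>power_module R n\<^esub> mat_map R n \<Phi> w"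
        using v w 1[of _ v w] f by (simp cong: restrict_cong)
      finally show ?thesis .
    qed
    show "mat_map R n \<Phi> (a \<odot>\<^bsub>power_module R n\<^esub> v) = a \<odot>\<^bsub>power_module R n\<^esub> mat_map R n \<Phi> v"
      if a: "a \<in> carrier R" for a
    proof -
      have "mat_map R n \<Phi> (a \<odot>\<^bsub>power_module R n\<^esub> v) = ?f (a \<odot>\<^bsub>power_module R n\<^esub> v)"
        using v a by (intro f N.smult_closed)
      also have "\<dots> = (\<lambda>i\<in>{..<n}. (\<Oplus>j\<in>{..<n}. \<Phi> i j \<otimes> (a \<otimes> v j)))"
      proof (rule restrict_ext)
        fix i assume "i \<in> {..<n}"
        then show "(\<Oplus>j\<in>{..<n}. \<Phi> i j \<otimes> (a \<odot>\<^bsub>power_module R n\<^esub> v) j)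
            = (\<Oplus>j\<in>{..<n}. \<Phi> i j \<otimes> (a \<otimes> v j))"
          using r[of i "\<lambda>j. a \<otimes> v j"] v a by (auto simp: PiE_def Pi_def simp del: restrict_apply)
      qed
      also have "\<dots> = a \<odot>\<^bsub>power_module R n\<^esub> mat_map R n \<Phi> v"
        using v a 2[of _ v a] f by (simp cong: restrict_cong)
      finally show ?thesis .
    qed
  qed
qed

lemma (in module) quotient_module_smult:
  assumes "submodule U R M" "a \<in> carrier R" "x \<in> carrier M"
  shows "a \<odot>\<^bsub>quotient_module M U\<^esub> (U +>\<^bsub>M\<^esub> x) = U +>\<^bsub>M\<^esub> (a \<odot>\<^bsub>M\<^esub> x)"
proof -
  interpret U: submodule U R M by (rule assms)
  interpret U: abelian_subgroup U M
    by (rule abelian_subgroupI3) (auto simp: additive_subgroup_def M.abelian_group_axioms U.subgroup_axioms)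
  have "U +>\<^bsub>M\<^esub> (a \<odot>\<^bsub>M\<^esub> y) = U +>\<^bsub>M\<^esub> (a \<odot>\<^bsub>M\<^esub> x)" if "y \<in> U +>\<^bsub>M\<^esub> x" for y
  proof -
    from that obtain u where u: "u \<in> U" "y = u \<oplus>\<^bsub>M\<^esub> x"
      by (auto simp: a_r_coset_def')
    then have "a \<odot>\<^bsub>M\<^esub> y = (a \<odot>\<^bsub>M\<^esub> u) \<oplus>\<^bsub>M\<^esub> (a \<odot>\<^bsub>M\<^esub> x)"
      using assms(2,3) smult_r_distr by auto
    moreover have "a \<odot>\<^bsub>M\<^esub> u \<in> U" using u assms(2) by auto
    ultimately have "a \<odot>\<^bsub>M\<^esub> y \<in> U +>\<^bsub>M\<^esub> (a \<odot>\<^bsub>M\<^esub> x)" by (auto simp: a_r_coset_def')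
    then show ?thesis
      using U.a_repr_independence' assms(2,3) by (metis smult_closed)
  qed
  moreover have "x \<in> U +>\<^bsub>M\<^esub> x" using assms(3) U.a_rcos_self by blast
  ultimately have "(\<Union>y\<in>U +>\<^bsub>M\<^esub> x. U +>\<^bsub>M\<^esub> (a \<odot>\<^bsub>M\<^esub> y)) = U +>\<^bsub>M\<^esub> (a \<odot>\<^bsub>M\<^esub> x)"
    by blast
  then show ?thesis by (simp only: quotient_module_def module.simps)
qed

lemma (in module) quotient_module:
  assumes "submodule U R M"
  shows "module R (quotient_module M U)"
proof -
  interpret U: submodule U R M by (rule assms)
  interpret U: abelian_subgroup U M
    by (rule abelian_subgroupI3) (auto simp: additive_subgroup_def M.abelian_group_axioms U.subgroup_axioms)
  let ?Q = "quotient_module M U"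
  have carr: "\<exists>x\<in>carrier M. X = U +>\<^bsub>M\<^esub> x" if "X \<in> carrier ?Q" for X
    using that by (auto simp: quotient_module_def A_RCOSETS_def')
  have carrI: "U +>\<^bsub>M\<^esub> x \<in> carrier ?Q" if "x \<in> carrier M" for x
    using that by (auto simp: quotient_module_def A_RCOSETS_def')
  have add: "(U +>\<^bsub>M\<^esub> x) \<oplus>\<^bsub>?Q\<^esub> (U +>\<^bsub>M\<^esub> y) = U +>\<^bsub>M\<^esub> (x \<oplus>\<^bsub>M\<^esub> y)"
    if "x \<in> carrier M" "y \<in> carrier M" for x y
    using that U.a_rcos_sum by (simp add: quotient_module_def)
  have zero: "\<zero>\<^bsub>?Q\<^esub> = U +>\<^bsub>M\<^esub> \<zero>\<^bsub>M\<^esub>"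
    using M.a_coset_add_zero[OF U.a_subset] by (simp add: quotient_module_def)
  note sm = quotient_module_smult[OF assms]
  show ?thesis
  proof (rule moduleI)
    show "abelian_group ?Q"
    proof (rule abelian_groupI)
      fix X assume "X \<in> carrier ?Q"
      then obtain x where x: "x \<in> carrier M" "X = U +>\<^bsub>M\<^esub> x" using carr by blast
      then show "\<exists>Y\<in>carrier ?Q. Y \<oplus>\<^bsub>?Q\<^esub> X = \<zero>\<^bsub>?Q\<^esub>"
        by (intro bexI[of _ "U +>\<^bsub>M\<^esub> (\<ominus>\<^bsub>M\<^esub> x)"]) (auto simp: add zero carrI M.l_neg)
    next
      fix X Y Z assume "X \<in> carrier ?Q" "Y \<in> carrier ?Q" "Z \<in> carrier ?Q"
      then obtain x y z where xyz: "x \<in> carrier M" "y \<in> carrier M" "z \<in> carrier M"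
        and eqs: "X = U +>\<^bsub>M\<^esub> x" "Y = U +>\<^bsub>M\<^esub> y" "Z = U +>\<^bsub>M\<^esub> z"
        using carr by meson
      show "X \<oplus>\<^bsub>?Q\<^esub> Y \<oplus>\<^bsub>?Q\<^esub> Z = X \<oplus>\<^bsub>?Q\<^esub> (Y \<oplus>\<^bsub>?Q\<^esub> Z)"
        unfolding eqs using xyz by (simp only: add M.a_closed M.a_assoc)
    next
      fix X Y assume "X \<in> carrier ?Q" "Y \<in> carrier ?Q"
      then obtain x y where xy: "x \<in> carrier M" "y \<in> carrier M"
        and eqs: "X = U +>\<^bsub>M\<^esub> x" "Y = U +>\<^bsub>M\<^esub> y"
        using carr by meson
      show "X \<oplus>\<^bsub>?Q\<^esub> Y \<in> carrier ?Q"
        unfolding eqs using xy by (simp only: add M.a_closed carrI)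
      show "X \<oplus>\<^bsub>?Q\<^esub> Y = Y \<oplus>\<^bsub>?Q\<^esub> X"
        unfolding eqs using xy M.a_comm[of x y] by (simp only: add)
    next
      fix X assume "X \<in> carrier ?Q"
      then obtain x where x: "x \<in> carrier M" and eqs: "X = U +>\<^bsub>M\<^esub> x" using carr by meson
      show "\<zero>\<^bsub>?Q\<^esub> \<oplus>\<^bsub>?Q\<^esub> X = X"
        unfolding eqs zero using x by (simp only: add M.zero_closed M.l_zero)
    next
      show "\<zero>\<^bsub>?Q\<^esub> \<in> carrier ?Q" unfolding zero by (rule carrI) simp
    qed
  next
    fix a X assume a: "a \<in> carrier R" and "X \<in> carrier ?Q"
    then obtain x where x: "x \<in> carrier M" and X: "X = U +>\<^bsub>M\<^esub> x" using carr by meson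
    show "a \<odot>\<^bsub>?Q\<^esub> X \<in> carrier ?Q"
      unfolding X using a x by (simp only: sm smult_closed carrI)
    fix b assume b: "b \<in> carrier R"
    show "(a \<oplus> b) \<odot>\<^bsub>?Q\<^esub> X = a \<odot>\<^bsub>?Q\<^esub> X \<oplus>\<^bsub>?Q\<^esub> b \<odot>\<^bsub>?Q\<^esub> X"
      unfolding X using a b x by (simp only: sm add smult_closed R.a_closed smult_l_distr)
    show "(a \<otimes> b) \<odot>\<^bsub>?Q\<^esub> X = a \<odot>\<^bsub>?Q\<^esub> (b \<odot>\<^bsub>?Q\<^esub> X)"
      unfolding X using a b x by (simp only: sm smult_closed R.m_closed smult_assoc1)
  next
    fix a X Y assume a: "a \<in> carrier R" and "X \<in> carrier ?Q" "Y \<in> carrier ?Q"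
    then obtain x y where xy: "x \<in> carrier M" "y \<in> carrier M"
      and eqs: "X = U +>\<^bsub>M\<^esub> x" "Y = U +>\<^bsub>M\<^esub> y" using carr by meson
    show "a \<odot>\<^bsub>?Q\<^esub> (X \<oplus>\<^bsub>?Q\<^esub> Y) = a \<odot>\<^bsub>?Q\<^esub> X \<oplus>\<^bsub>?Q\<^esub> a \<odot>\<^bsub>?Q\<^esub> Y"
      unfolding eqs using a xy by (simp only: sm add smult_closed M.a_closed smult_r_distr)
  next
    fix X assume "X \<in> carrier ?Q"
    then obtain x where x: "x \<in> carrier M" and X: "X = U +>\<^bsub>M\<^esub> x" using carr by meson
    show "\<one> \<odot>\<^bsub>?Q\<^esub> X = X"
      unfolding X using x by (simp only: sm R.one_closed smult_one)
  qed (rule is_cring)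
qed

lemma (in cring) mod_hom_image_submodule:
  assumes "module R M" "module R N" "f \<in> mod_hom R M N"
  shows "submodule (f ` carrier M) R N"
proof -
  interpret M: module R M by fact
  interpret N: module R N by fact
  have f: "f x \<in> carrier N" if "x \<in> carrier M" for x using assms(3) that by (auto simp: mod_hom_def)
  have fa: "f (x \<oplus>\<^bsub>M\<^esub> y) = f x \<oplus>\<^bsub>N\<^esub> f y" if "x \<in> carrier M" "y \<in> carrier M" for x y
    using assms(3) that by (auto simp: mod_hom_def)
  have fs: "f (a \<odot>\<^bsub>M\<^esub> x) = a \<odot>\<^bsub>N\<^esub> f x" if "a \<in> carrier R" "x \<in> carrier M" for a x
    using assms(3) that by (auto simp: mod_hom_def)
  show ?thesis
  proof (rule N.submoduleI)
    have "f \<zero>\<^bsub>M\<^esub> = \<zero>\<^bsub>N\<^esub>"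
      using fs[of \<zero> "\<zero>\<^bsub>M\<^esub>"] f by simp
    then show "\<zero>\<^bsub>N\<^esub> \<in> f ` carrier M" by force
    show "\<ominus>\<^bsub>N\<^esub> y \<in> f ` carrier M" if "y \<in> f ` carrier M" for y
    proof -
      from that obtain x where x: "x \<in> carrier M" "y = f x" by auto
      then have "f (\<ominus> \<one> \<odot>\<^bsub>M\<^esub> x) = \<ominus>\<^bsub>N\<^esub> y"
        using fs[of "\<ominus> \<one>" x] f N.smult_l_minus[of \<one> "f x"] by simp
      then show ?thesis using x by (metis a_inv_closed one_closed M.smult_closed imageI)
    qed
  qed (use f fa fs in \<open>auto simp flip: fa fs\<close>)
qed

text \<open>The first map of the composite is well defined and injective, and the second one is bijective.\<close>

lemma (in module) quotient_proj_hom: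
  assumes "submodule U R M"
  shows "quotient_proj M U \<in> mod_hom R M (quotient_module M U)"
    and "quotient_proj M U ` carrier M = carrier (quotient_module M U)"
proof -
  interpret U: submodule U R M by (rule assms)
  interpret U: abelian_subgroup U M
    by (rule abelian_subgroupI3) (auto simp: additive_subgroup_def M.abelian_group_axioms U.subgroup_axioms)
  show "quotient_proj M U ` carrier M = carrier (quotient_module M U)"
    by (auto simp: quotient_proj_def quotient_module_def A_RCOSETS_def')
  then show "quotient_proj M U \<in> mod_hom R M (quotient_module M U)"
    using quotient_module_smult[OF assms] U.a_rcos_sum
    by (auto simp: mod_hom_def quotient_proj_def) (simp_all add: quotient_module_def)
qed

lemma hom_precomp_closed:
  assumes "module A M" "h \<in> mod_hom A M N" "f \<in> mod_hom A N L"
  shows "hom_precomp M h f \<in> mod_hom A M L"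
proof -
  interpret M: module A M by fact
  show ?thesis using assms(2,3)
    by (auto simp: mod_hom_def hom_precomp_def compose_def Pi_def PiE_def)
qed

lemma hom_precomp_inj:
  assumes "h ` carrier M = carrier N"
  shows "inj_on (hom_precomp M h) (mod_hom A N L)"
proof (rule inj_onI)
  fix f f' assume f: "f \<in> mod_hom A N L" "f' \<in> mod_hom A N L" "hom_precomp M h f = hom_precomp M h f'"
  have "f (h x) = f' (h x)" if "x \<in> carrier M" for x
    using fun_cong[OF f(3), of x] that by (simp add: hom_precomp_def compose_def)
  then have "f y = f' y" if "y \<in> carrier N" for y using that assms by (metis imageE)
  then show "f = f'"
    using f by (intro extensionalityI[of _ "carrier N"]) (auto simp: mod_hom_def PiE_def)
qed

lemma (in cring) dual_coords_bij:
  "bij_betw (dual_coords R n) (mod_hom R (power_module R n) (self_module R)) (carrier (power_module R n))"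
proof -
  let ?F = "power_module R n" and ?e = "std_basis R n"
  interpret N: module R ?F by (rule power_module)
  let ?g = "\<lambda>a. \<lambda>v\<in>carrier ?F. \<Oplus>i\<in>{..<n}. v i \<otimes> a i"
  have expand: "f v = (\<Oplus>i\<in>{..<n}. v i \<otimes> f (?e i))"
    if f: "f \<in> mod_hom R ?F (self_module R)" and v: "v \<in> carrier ?F" for f v
  proof -
    have fc: "f x \<in> carrier R" if "x \<in> carrier ?F" for x using f that by (auto simp: mod_hom_def)
    have fa: "f (x \<oplus>\<^bsub>?F\<^esub> y) = f x \<oplus> f y" if "x \<in> carrier ?F" "y \<in> carrier ?F" for x y
      using f that by (auto simp: mod_hom_def simp del: power_module_simps)
    have fs: "f (a \<odot>\<^bsub>?F\<^esub> x) = a \<otimes> f x" if "a \<in> carrier R" "x \<in> carrier ?F" for a x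
      using f that by (auto simp: mod_hom_def simp del: power_module_simps)
    have f0: "f \<zero>\<^bsub>?F\<^esub> = \<zero>"
      using fs[of \<zero> "\<zero>\<^bsub>?F\<^esub>"] fc[of "\<zero>\<^bsub>?F\<^esub>"] N.smult_l_null[of "\<zero>\<^bsub>?F\<^esub>"]
      by (simp del: power_module_simps)
    have vi: "v i \<in> carrier R" if "i < n" for i using v that by auto
    have cl: "v i \<odot>\<^bsub>?F\<^esub> ?e i \<in> carrier ?F" if "i < n" for i
      by (rule N.smult_closed[OF vi[OF that] std_basis_closed])
    have sum: "f (\<Oplus>\<^bsub>?F\<^esub>i\<in>X. v i \<odot>\<^bsub>?F\<^esub> ?e i) = (\<Oplus>i\<in>X. v i \<otimes> f (?e i))"
      if "finite X" "X \<subseteq> {..<n}" for X using that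
    proof (induction X rule: finite_induct)
      case empty then show ?case using f0 by (simp del: power_module_simps)
    next
      case (insert x X)
      then have 1: "(\<lambda>i. v i \<odot>\<^bsub>?F\<^esub> ?e i) \<in> X \<rightarrow> carrier ?F" "v x \<odot>\<^bsub>?F\<^esub> ?e x \<in> carrier ?F"
        and 2: "(\<lambda>i. v i \<otimes> f (?e i)) \<in> X \<rightarrow> carrier R" "v x \<otimes> f (?e x) \<in> carrier R"
        using cl vi fc by (auto simp del: power_module_simps)
      have "f (\<Oplus>\<^bsub>?F\<^esub>i\<in>insert x X. v i \<odot>\<^bsub>?F\<^esub> ?e i)
          = f (v x \<odot>\<^bsub>?F\<^esub> ?e x) \<oplus> f (\<Oplus>\<^bsub>?F\<^esub>i\<in>X. v i \<odot>\<^bsub>?F\<^esub> ?e i)"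
        using insert 1 by (simp add: N.finsum_insert fa N.finsum_closed del: power_module_simps)
      also have "f (v x \<odot>\<^bsub>?F\<^esub> ?e x) = v x \<otimes> f (?e x)"
        by (rule fs[OF vi std_basis_closed]) (use insert in auto)
      finally show ?case using insert 2 by (simp add: finsum_insert del: power_module_simps)
    qed
    have "v = (\<Oplus>\<^bsub>?F\<^esub>i\<in>{..<n}. v i \<odot>\<^bsub>?F\<^esub> ?e i)"
    proof (rule extensionalityI[of _ "{..<n}"])
      show "v \<in> extensional {..<n}" using v by (simp add: PiE_def)
      have "(\<Oplus>\<^bsub>?F\<^esub>i\<in>{..<n}. v i \<odot>\<^bsub>?F\<^esub> ?e i) \<in> carrier ?F"
        using cl by (intro N.finsum_closed) (auto simp del: power_module_simps)
      then show "(\<Oplus>\<^bsub>?F\<^esub>i\<in>{..<n}. v i \<odot>\<^bsub>?F\<^esub> ?e i) \<in> extensional {..<n}"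
        by (simp add: PiE_def)
    next
      fix i assume "i \<in> {..<n}"
      then show "v i = (\<Oplus>\<^bsub>?F\<^esub>i\<in>{..<n}. v i \<odot>\<^bsub>?F\<^esub> ?e i) i"
        using std_basis_expansion[of "{..<n}" n v i] vi by (simp del: power_module_simps)
    qed
    then show ?thesis using sum[of "{..<n}"] by simp
  qed
  show ?thesis
  proof (rule bij_betwI')
    fix f f' assume f: "f \<in> mod_hom R ?F (self_module R)" "f' \<in> mod_hom R ?F (self_module R)"
    show "(dual_coords R n f = dual_coords R n f') = (f = f')"
    proof
      assume eq: "dual_coords R n f = dual_coords R n f'"
      have e: "f (?e i) = f' (?e i)" if "i < n" for i
        using fun_cong[OF eq, of i] that by (simp add: dual_coords_def)
      have fe: "f' (?e i) \<in> carrier R" for i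
        using f(2) std_basis_closed[of n i] unfolding mod_hom_def self_module_simps by blast
      show "f = f'"
      proof (rule extensionalityI[of _ "carrier ?F"])
        fix v assume v: "v \<in> carrier ?F"
        have "(\<Oplus>i\<in>{..<n}. v i \<otimes> f (?e i)) = (\<Oplus>i\<in>{..<n}. v i \<otimes> f' (?e i))"
          using v e fe by (intro finsum_cong') (auto simp: PiE_def Pi_def)
        then show "f v = f' v" using expand f v by simp
      qed (use f in \<open>auto simp: mod_hom_def PiE_def\<close>)
    qed simp
  next
    fix f assume f: "f \<in> mod_hom R ?F (self_module R)"
    have "f (?e i) \<in> carrier R" for i
      using f std_basis_closed[of n i] unfolding mod_hom_def self_module_simps by blast
    then show "dual_coords R n f \<in> carrier ?F" by (auto simp: dual_coords_def)
  next
    fix a assume a: "a \<in> carrier ?F"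
    have "mat_map R n (\<lambda>i j. a j) \<in> mod_hom R ?F ?F"
      using a by (intro mat_map_hom) auto
    then have m: "mat_map R n (\<lambda>i j. a j) \<in> mod_hom R ?F ?F" .
    have ai: "a i \<in> carrier R" if "i < n" for i using a that by auto
    let ?f = "\<lambda>v\<in>carrier ?F. \<Oplus>j\<in>{..<n}. a j \<otimes> v j"
    show "\<exists>f\<in>mod_hom R ?F (self_module R). a = dual_coords R n f"
    proof (cases "n = 0")
      case True
      then have "(\<lambda>v\<in>carrier ?F. \<zero>) \<in> mod_hom R ?F (self_module R)"
        by (auto simp: mod_hom_def)
      moreover have "a = dual_coords R n (\<lambda>v\<in>carrier ?F. \<zero>)"
        using a True by (auto simp: dual_coords_def)
      ultimately show ?thesis by blast
    next
      case False
      have fv: "?f v = mat_map R n (\<lambda>i j. a j) v 0" if "v \<in> carrier ?F" for v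
        using that False by (simp add: mat_map_def)
      have "?f \<in> mod_hom R ?F (self_module R)"
        unfolding mod_hom_def
      proof (intro CollectI conjI ballI)
        show "?f \<in> carrier ?F \<rightarrow>\<^sub>E carrier (self_module R)"
        proof (rule restrict_PiE_iff[THEN iffD2], rule ballI)
          fix v assume "v \<in> carrier ?F"
          then show "(\<Oplus>j\<in>{..<n}. a j \<otimes> v j) \<in> carrier (self_module R)"
            using ai by (auto intro!: finsum_closed simp: PiE_def Pi_def)
        qed
        fix v assume v: "v \<in> carrier ?F"
        show "?f (v \<oplus>\<^bsub>?F\<^esub> w) = ?f v \<oplus>\<^bsub>self_module R\<^esub> ?f w" if w: "w \<in> carrier ?F" for w
        proof -
          have "mat_map R n (\<lambda>i j. a j) (v \<oplus>\<^bsub>?F\<^esub> w)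
              = mat_map R n (\<lambda>i j. a j) v \<oplus>\<^bsub>?F\<^esub> mat_map R n (\<lambda>i j. a j) w"
            using m v w unfolding mod_hom_def by blast
          then show ?thesis unfolding fv[OF v] fv[OF w] fv[OF N.a_closed[OF v w]]
            using False by simp
        qed
        show "?f (r \<odot>\<^bsub>?F\<^esub> v) = r \<odot>\<^bsub>self_module R\<^esub> ?f v" if r: "r \<in> carrier R" for r
        proof -
          have "mat_map R n (\<lambda>i j. a j) (r \<odot>\<^bsub>?F\<^esub> v) = r \<odot>\<^bsub>?F\<^esub> mat_map R n (\<lambda>i j. a j) v"
            using m v r unfolding mod_hom_def by blast
          then show ?thesis unfolding fv[OF v] fv[OF N.smult_closed[OF r v]]
            using False by simp
        qed
      qed
      moreover have "a = dual_coords R n ?f"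
      proof (rule extensionalityI[of _ "{..<n}"])
        fix i assume i: "i \<in> {..<n}"
        have "?f (?e i) = (\<Oplus>j\<in>{..<n}. a j \<otimes> ?e i j)"
          using std_basis_closed[of n i] by (simp del: power_module_simps)
        also have "\<dots> = (\<Oplus>j\<in>{..<n}. a j \<otimes> (if i = j then \<one> else \<zero>))"
          using ai by (intro finsum_cong') (auto simp: std_basis_def)
        also have "\<dots> = a i" using finsum_delta[of "{..<n}" a i] ai i by simp
        finally show "a i = dual_coords R n ?f i" using i by (simp add: dual_coords_def)
      qed (use a in \<open>auto simp: dual_coords_def PiE_def\<close>)
      ultimately show ?thesis by blast
    qed
  qed
qed

end

theory Submission
  imports Defs
begin

text \<open>
  Write \<open>A = z Id - \<phi>\<close> and \<open>B = z Id + \<phi>\<close>, so that \<open>AB = BA = x Id\<close> with \<open>x = z\<^sup>2 + g\<close>. The theorem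
  combines two observations.

  A homomorphism \<open>M \<rightarrow> R\<close> is the same as a homomorphism \<open>R\<^sup>n \<rightarrow> R\<close> that vanishes on the image of
  \<open>A\<close>. The homomorphisms \<open>R\<^sup>n \<rightarrow> R\<close> are the functionals \<open>v \<mapsto> \<Sum>i. a i * v i\<close>, and such a functional
  vanishes on the image of \<open>A\<close> exactly if \<open>A\<^sup>T a = 0\<close>. Hence the image of \<open>Hom(M, R)\<close> in \<open>R\<^sup>n\<close> is the
  kernel of \<open>A\<^sup>T\<close> over \<open>R\<close>; this holds for every square matrix over a commutative ring
  (\<open>dual_coker_eq_kernel_transpose\<close>).

  It remains to see that over \<open>R\<close> the kernel of \<open>A\<^sup>T\<close> is the image of \<open>B\<^sup>T = z Id + \<phi>\<^sup>T\<close>. The pair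
  \<open>(A\<^sup>T, B\<^sup>T)\<close> is again a factorization of \<open>x\<close> (\<open>transpose_factorization\<close>). If \<open>A\<^sup>T a = x b\<close> holds for
  vectors over \<open>S\<lbrakk>z\<rbrakk>\<close>, multiplying by \<open>B\<^sup>T\<close> gives \<open>x a = x B\<^sup>T b\<close>, and \<open>a = B\<^sup>T b\<close> follows as soon as
  \<open>x\<close> is not a zero divisor (\<open>factorization_exact_mod_nonzerodivisor\<close>).

  That \<open>z\<^sup>2 + g\<close> is not a zero divisor in \<open>S\<lbrakk>z\<rbrakk>\<close> is where the Noetherian hypothesis enters
  (\<open>ps_z_sq_plus_const_nonzerodivisor\<close>). If \<open>(z\<^sup>2 + g) p = 0\<close>, then every coefficient of \<open>p\<close> is killed
  by some power of \<open>g\<close>, hence by one fixed power \<open>g\<^sup>N\<close>; but every coefficient of \<open>p\<close> is also, up to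
  sign, \<open>g\<^sup>N\<close> times a later coefficient, so it is zero.
\<close>

section \<open>Vectors and matrices\<close>

lemma mat_map_nth:
  "v \<in> carrier (power_module A n) \<Longrightarrow> i < n \<Longrightarrow>
    mat_map A n \<Phi> v i = (\<Oplus>\<^bsub>A\<^esub>j\<in>{..<n}. \<Phi> i j \<otimes>\<^bsub>A\<^esub> v j)"
  by (simp add: mat_map_def)

lemma power_module_eqI:
  assumes "v \<in> carrier (power_module A n)" "w \<in> carrier (power_module A n)"
    and "\<And>i. i < n \<Longrightarrow> v i = w i"
  shows "v = w"
  using assms by (intro extensionalityI[of v "{..<n}"]) (auto simp: PiE_def)

lemma (in cring) mat_map_closed:
  assumes "\<And>i j. i < n \<Longrightarrow> j < n \<Longrightarrow> \<Phi> i j \<in> carrier R" "v \<in> carrier (power_module R n)"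
  shows "mat_map R n \<Phi> v \<in> carrier (power_module R n)"
proof -
  have "mat_map R n \<Phi> \<in> mod_hom R (power_module R n) (power_module R n)"
    using assms(1) by (rule mat_map_hom)
  then show ?thesis using assms(2) unfolding mod_hom_def by blast
qed

lemma (in abelian_monoid) finsum_exchange:
  assumes "finite X" "finite Y" "\<And>i j. i \<in> X \<Longrightarrow> j \<in> Y \<Longrightarrow> f i j \<in> carrier G"
  shows "(\<Oplus>i\<in>X. \<Oplus>j\<in>Y. f i j) = (\<Oplus>j\<in>Y. \<Oplus>i\<in>X. f i j)"
  using assms(1,3)
proof (induction X rule: finite_induct)
  case empty
  then show ?case by simp
next
  case (insert x X)
  have f: "f x j \<in> carrier G" "(\<Oplus>i\<in>X. f i j) \<in> carrier G" if "j \<in> Y" for j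
    using insert.prems that by (auto intro!: finsum_closed)
  have "(\<Oplus>i\<in>insert x X. \<Oplus>j\<in>Y. f i j) = (\<Oplus>j\<in>Y. f x j) \<oplus> (\<Oplus>i\<in>X. \<Oplus>j\<in>Y. f i j)"
    using insert by (intro finsum_insert) (auto intro!: finsum_closed)
  also have "\<dots> = (\<Oplus>j\<in>Y. f x j) \<oplus> (\<Oplus>j\<in>Y. \<Oplus>i\<in>X. f i j)"
    using insert by auto
  also have "\<dots> = (\<Oplus>j\<in>Y. f x j \<oplus> (\<Oplus>i\<in>X. f i j))"
    using f by (intro finsum_addf[symmetric]) auto
  also have "\<dots> = (\<Oplus>j\<in>Y. \<Oplus>i\<in>insert x X. f i j)"
    using insert f by (intro finsum_cong' refl) (auto intro!: finsum_insert[symmetric])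
  finally show ?case .
qed

section \<open>Homomorphisms out of a quotient module\<close>

text \<open>The universal property of the quotient: a homomorphism that vanishes on \<open>U\<close> takes the same value on
  all representatives of a coset, so it factors through the projection.\<close>

lemma (in module) hom_precomp_quotient_proj_image:
  assumes U: "submodule U R M" and N: "module R N"
  shows "hom_precomp M (quotient_proj M U) ` mod_hom R (quotient_module M U) N
    = {h \<in> mod_hom R M N. \<forall>u\<in>U. h u = \<zero>\<^bsub>N\<^esub>}" (is "?L = ?R")
proof
  interpret U: submodule U R M by (rule U)
  interpret U: abelian_subgroup U M
    by (rule abelian_subgroupI3)
      (auto simp: additive_subgroup_def M.abelian_group_axioms U.subgroup_axioms)
  interpret N: module R N by (rule N)
  interpret Q: module R "quotient_module M U" by (rule quotient_module[OF U])
  let ?Q = "quotient_module M U"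
  have coset: "U +>\<^bsub>M\<^esub> v \<in> carrier ?Q" if "v \<in> carrier M" for v
    using that by (auto simp: quotient_module_def A_RCOSETS_def')
  show "?L \<subseteq> ?R"
  proof clarify
    fix f assume f: "f \<in> mod_hom R ?Q N"
    have "f \<zero>\<^bsub>?Q\<^esub> = f (\<zero> \<odot>\<^bsub>?Q\<^esub> \<zero>\<^bsub>?Q\<^esub>)" by simp
    also have "\<dots> = \<zero> \<odot>\<^bsub>N\<^esub> f \<zero>\<^bsub>?Q\<^esub>"
      using f Q.zero_closed R.zero_closed unfolding mod_hom_def by blast
    also have "\<dots> = \<zero>\<^bsub>N\<^esub>"
      using f Q.zero_closed by (intro N.smult_l_null) (auto simp: mod_hom_def)
    finally have f0: "f U = \<zero>\<^bsub>N\<^esub>" by (simp add: quotient_module_def)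
    have "hom_precomp M (quotient_proj M U) f u = \<zero>\<^bsub>N\<^esub>" if "u \<in> U" for u
      using that f0 U.a_rcos_const[OF that] U.a_subset
      by (auto simp: hom_precomp_def compose_def quotient_proj_def)
    then show "hom_precomp M (quotient_proj M U) f \<in> mod_hom R M N \<and>
        (\<forall>u\<in>U. hom_precomp M (quotient_proj M U) f u = \<zero>\<^bsub>N\<^esub>)"
      using hom_precomp_closed[OF module_axioms quotient_proj_hom(1)[OF U] f] by blast
  qed
  show "?R \<subseteq> ?L"
  proof clarify
    fix h assume h: "h \<in> mod_hom R M N" and h0: "\<forall>u\<in>U. h u = \<zero>\<^bsub>N\<^esub>"
    have hc: "h v \<in> carrier N" if "v \<in> carrier M" for v
      using h that by (auto simp: mod_hom_def)
    have ha: "h (v \<oplus>\<^bsub>M\<^esub> w) = h v \<oplus>\<^bsub>N\<^esub> h w" if "v \<in> carrier M" "w \<in> carrier M" for v w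
      using h that by (auto simp: mod_hom_def)
    have hs: "h (a \<odot>\<^bsub>M\<^esub> v) = a \<odot>\<^bsub>N\<^esub> h v" if "a \<in> carrier R" "v \<in> carrier M" for a v
      using h that by (auto simp: mod_hom_def)
    \<comment> \<open>The factored map evaluates \<open>h\<close> at an arbitrary representative of each coset.\<close>
    define f where "f = (\<lambda>X\<in>carrier ?Q. h (SOME v. v \<in> X))"
    have fh: "f (U +>\<^bsub>M\<^esub> v) = h v" if v: "v \<in> carrier M" for v
    proof -
      have "(SOME w. w \<in> U +>\<^bsub>M\<^esub> v) \<in> U +>\<^bsub>M\<^esub> v"
        using U.a_rcos_self[OF v] by (rule someI)
      then obtain u where u: "u \<in> U" "(SOME w. w \<in> U +>\<^bsub>M\<^esub> v) = u \<oplus>\<^bsub>M\<^esub> v"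
        by (auto simp: a_r_coset_def')
      have "h (u \<oplus>\<^bsub>M\<^esub> v) = h v"
        using u(1) v h0 hc U.a_subset by (subst ha) auto
      then show ?thesis using u(2) coset[OF v] by (simp add: f_def)
    qed
    have rep: "\<exists>v\<in>carrier M. X = U +>\<^bsub>M\<^esub> v" if "X \<in> carrier ?Q" for X
      using that by (auto simp: quotient_module_def A_RCOSETS_def')
    have "f \<in> mod_hom R ?Q N"
      unfolding mod_hom_def
    proof (intro CollectI conjI ballI)
      show "f \<in> carrier ?Q \<rightarrow>\<^sub>E carrier N"
      proof (rule PiE_I)
        fix X assume "X \<in> carrier ?Q"
        then show "f X \<in> carrier N" using rep fh hc by metis
      qed (simp add: f_def)
    next
      fix X Y assume "X \<in> carrier ?Q" "Y \<in> carrier ?Q"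
      then obtain v w where v: "v \<in> carrier M" "X = U +>\<^bsub>M\<^esub> v"
        and w: "w \<in> carrier M" "Y = U +>\<^bsub>M\<^esub> w"
        using rep by meson
      have "X \<oplus>\<^bsub>?Q\<^esub> Y = U +>\<^bsub>M\<^esub> (v \<oplus>\<^bsub>M\<^esub> w)"
        using v w U.a_rcos_sum by (simp add: quotient_module_def)
      then show "f (X \<oplus>\<^bsub>?Q\<^esub> Y) = f X \<oplus>\<^bsub>N\<^esub> f Y"
        using v w by (simp add: fh ha)
    next
      fix a X assume a: "a \<in> carrier R" and "X \<in> carrier ?Q"
      then obtain v where v: "v \<in> carrier M" "X = U +>\<^bsub>M\<^esub> v" using rep by meson
      show "f (a \<odot>\<^bsub>?Q\<^esub> X) = a \<odot>\<^bsub>N\<^esub> f X"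
        using a v by (simp add: quotient_module_smult[OF U] fh hs)
    qed
    moreover have "h = hom_precomp M (quotient_proj M U) f"
    proof (rule extensionalityI[of _ "carrier M"])
      show "h \<in> extensional (carrier M)" using h by (auto simp: mod_hom_def PiE_def)
      show "hom_precomp M (quotient_proj M U) f \<in> extensional (carrier M)"
        by (simp add: hom_precomp_def compose_def)
      show "h v = hom_precomp M (quotient_proj M U) f v" if "v \<in> carrier M" for v
        using that fh by (simp add: hom_precomp_def compose_def quotient_proj_def)
    qed
    ultimately show "h \<in> ?L" by blast
  qed
qed

section \<open>Functionals on a free module\<close>

text \<open>Restricting the functional to the carrier makes it extensional, as membership in \<open>mod_hom\<close> demands.\<close>

definition dot_form :: "('a, 'k) ring_scheme \<Rightarrow> nat \<Rightarrow> (nat \<Rightarrow> 'a) \<Rightarrow> (nat \<Rightarrow> 'a) \<Rightarrow> 'a" where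
  "dot_form A n a = (\<lambda>v\<in>carrier (power_module A n). \<Oplus>\<^bsub>A\<^esub>i\<in>{..<n}. a i \<otimes>\<^bsub>A\<^esub> v i)"

lemma dot_form_apply:
  "v \<in> carrier (power_module A n) \<Longrightarrow>
    dot_form A n a v = (\<Oplus>\<^bsub>A\<^esub>i\<in>{..<n}. a i \<otimes>\<^bsub>A\<^esub> v i)"
  by (simp add: dot_form_def)

context cring
begin

lemma dual_coords_closed:
  assumes "h \<in> mod_hom R (power_module R n) (self_module R)"
  shows "dual_coords R n h \<in> carrier (power_module R n)"
  using dual_coords_bij assms unfolding bij_betw_def by blast

lemma dot_form_hom:
  assumes a: "a \<in> carrier (power_module R n)"
  shows "dot_form R n a \<in> mod_hom R (power_module R n) (self_module R)"
proof -
  let ?F = "power_module R n"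
  interpret N: module R ?F by (rule power_module)
  have c: "dot_form R n a v \<in> carrier R" if "v \<in> carrier ?F" for v
    using that a unfolding dot_form_apply[OF that]
    by (intro finsum_closed) (auto simp: PiE_def Pi_def)
  show ?thesis
    unfolding mod_hom_def
  proof (intro CollectI conjI ballI)
    show "dot_form R n a \<in> carrier ?F \<rightarrow>\<^sub>E carrier (self_module R)"
      using c by (intro PiE_I) (auto simp: dot_form_def)
  next
    fix v w assume v: "v \<in> carrier ?F" and w: "w \<in> carrier ?F"
    have "(\<Oplus>i\<in>{..<n}. a i \<otimes> (v \<oplus>\<^bsub>?F\<^esub> w) i) = (\<Oplus>i\<in>{..<n}. a i \<otimes> v i \<oplus> a i \<otimes> w i)"
      by (rule finsum_cong') (use a v w in \<open>auto simp: r_distr PiE_def Pi_def\<close>)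
    also have "\<dots> = (\<Oplus>i\<in>{..<n}. a i \<otimes> v i) \<oplus> (\<Oplus>i\<in>{..<n}. a i \<otimes> w i)"
      by (rule finsum_addf) (use a v w in \<open>auto simp: PiE_def Pi_def\<close>)
    finally show "dot_form R n a (v \<oplus>\<^bsub>?F\<^esub> w)
        = dot_form R n a v \<oplus>\<^bsub>self_module R\<^esub> dot_form R n a w"
      using dot_form_apply[OF v] dot_form_apply[OF w] dot_form_apply[OF N.a_closed[OF v w]] by simp
  next
    fix r v assume r: "r \<in> carrier R" and v: "v \<in> carrier ?F"
    have "(\<Oplus>i\<in>{..<n}. a i \<otimes> (r \<odot>\<^bsub>?F\<^esub> v) i) = (\<Oplus>i\<in>{..<n}. r \<otimes> (a i \<otimes> v i))"
      by (rule finsum_cong') (use a v r in \<open>auto simp: m_lcomm PiE_def Pi_def\<close>)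
    also have "\<dots> = r \<otimes> (\<Oplus>i\<in>{..<n}. a i \<otimes> v i)"
      by (rule finsum_rdistr[symmetric]) (use a v r in \<open>auto simp: PiE_def Pi_def\<close>)
    finally show "dot_form R n a (r \<odot>\<^bsub>?F\<^esub> v) = r \<odot>\<^bsub>self_module R\<^esub> dot_form R n a v"
      using dot_form_apply[OF v] dot_form_apply[OF N.smult_closed[OF r v]] by simp
  qed
qed

lemma dual_coords_dot_form:
  assumes a: "a \<in> carrier (power_module R n)"
  shows "dual_coords R n (dot_form R n a) = a"
proof (rule power_module_eqI[OF dual_coords_closed[OF dot_form_hom[OF a]] a])
  fix i assume i: "i < n"
  have "dot_form R n a (std_basis R n i) = (\<Oplus>j\<in>{..<n}. a j \<otimes> (if i = j then \<one> else \<zero>))"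
    unfolding dot_form_apply[OF std_basis_closed]
    by (rule finsum_cong') (use a in \<open>auto simp: std_basis_def PiE_def Pi_def\<close>)
  also have "\<dots> = a i"
    using finsum_delta[of "{..<n}" a i] a i by (auto simp: PiE_def Pi_def)
  finally show "dual_coords R n (dot_form R n a) i = a i"
    using i by (simp add: dual_coords_def)
qed

text \<open>Both sides have the same coordinates on the standard basis, and these determine a functional.\<close>

lemma dot_form_dual_coords:
  assumes h: "h \<in> mod_hom R (power_module R n) (self_module R)"
  shows "dot_form R n (dual_coords R n h) = h"
  using dual_coords_bij[of n] h dot_form_hom[OF dual_coords_closed[OF h]]
    dual_coords_dot_form[OF dual_coords_closed[OF h]]
  by (auto simp: bij_betw_def inj_on_def)

lemma dot_form_eqD:
  assumes "a \<in> carrier (power_module R n)" "b \<in> carrier (power_module R n)"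
    and "\<And>v. v \<in> carrier (power_module R n) \<Longrightarrow> dot_form R n a v = dot_form R n b v"
  shows "a = b"
proof -
  have "dot_form R n a = dot_form R n b"
    using assms(3)
    by (intro extensionalityI[of _ "carrier (power_module R n)"])
      (simp_all add: dot_form_def del: power_module_simps)
  then show ?thesis using dual_coords_dot_form assms(1,2) by metis
qed

text \<open>The transpose is the adjoint for the pairing \<open>\<Sum>i. a i * v i\<close>. Through this identity, statements about
  transposes reduce to statements about the maps themselves, without any matrix products.\<close>

lemma dot_form_mat_map:
  assumes \<Phi>: "\<And>i j. i < n \<Longrightarrow> j < n \<Longrightarrow> \<Phi> i j \<in> carrier R"
    and a: "a \<in> carrier (power_module R n)" and v: "v \<in> carrier (power_module R n)"
  shows "dot_form R n a (mat_map R n \<Phi> v) = dot_form R n (mat_map R n (mat_transpose \<Phi>) a) v"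
proof -
  have ai: "a i \<in> carrier R" and vi: "v i \<in> carrier R" if "i < n" for i
    using a v that by auto
  have \<Phi>v: "mat_map R n \<Phi> v \<in> carrier (power_module R n)"
    using \<Phi> v by (rule mat_map_closed)
  have "dot_form R n a (mat_map R n \<Phi> v) = (\<Oplus>i\<in>{..<n}. a i \<otimes> (\<Oplus>j\<in>{..<n}. \<Phi> i j \<otimes> v j))"
    unfolding dot_form_apply[OF \<Phi>v]
    by (rule finsum_cong')
      (use ai vi \<Phi> in \<open>auto simp: mat_map_nth[OF v] simp del: power_module_simps intro!: finsum_closed\<close>)
  also have "\<dots> = (\<Oplus>i\<in>{..<n}. \<Oplus>j\<in>{..<n}. a i \<otimes> (\<Phi> i j \<otimes> v j))"
    by (rule finsum_cong')
      (use ai vi \<Phi> in \<open>auto intro!: finsum_closed finsum_rdistr\<close>)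
  also have "\<dots> = (\<Oplus>j\<in>{..<n}. \<Oplus>i\<in>{..<n}. a i \<otimes> (\<Phi> i j \<otimes> v j))"
    by (rule finsum_exchange) (use ai vi \<Phi> in auto)
  also have "\<dots> = (\<Oplus>j\<in>{..<n}. \<Oplus>i\<in>{..<n}. (\<Phi> i j \<otimes> a i) \<otimes> v j)"
    by (intro finsum_cong' refl) (use ai vi \<Phi> in \<open>auto simp: m_ac intro!: finsum_closed\<close>)
  also have "\<dots> = (\<Oplus>j\<in>{..<n}. (\<Oplus>i\<in>{..<n}. \<Phi> i j \<otimes> a i) \<otimes> v j)"
    by (rule finsum_cong')
      (use ai vi \<Phi> in \<open>auto intro!: finsum_closed finsum_ldistr[symmetric]\<close>)
  also have "\<dots> = dot_form R n (mat_map R n (mat_transpose \<Phi>) a) v"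
    unfolding dot_form_apply[OF v]
    by (rule finsum_cong')
      (use ai vi \<Phi> in \<open>auto simp: mat_map_nth[OF a] mat_transpose_def simp del: power_module_simps intro!: finsum_closed\<close>)
  finally show ?thesis .
qed

text \<open>By adjointness, pairing \<open>\<Psi>\<^sup>T \<Phi>\<^sup>T a\<close> with \<open>v\<close> amounts to pairing \<open>a\<close> with \<open>\<Phi> \<Psi> v = x v\<close>, and a vector
  is determined by its pairings.\<close>

lemma transpose_factorization:
  assumes \<Phi>: "\<And>i j. i < n \<Longrightarrow> j < n \<Longrightarrow> \<Phi> i j \<in> carrier R"
    and \<Psi>: "\<And>i j. i < n \<Longrightarrow> j < n \<Longrightarrow> \<Psi> i j \<in> carrier R"
    and x: "x \<in> carrier R"
    and \<Phi>\<Psi>: "\<And>v. v \<in> carrier (power_module R n) \<Longrightarrow>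
      mat_map R n \<Phi> (mat_map R n \<Psi> v) = x \<odot>\<^bsub>power_module R n\<^esub> v"
    and a: "a \<in> carrier (power_module R n)"
  shows "mat_map R n (mat_transpose \<Psi>) (mat_map R n (mat_transpose \<Phi>) a)
    = x \<odot>\<^bsub>power_module R n\<^esub> a"
proof -
  let ?F = "power_module R n"
  interpret F: module R ?F by (rule power_module)
  have tc: "mat_map R n (mat_transpose \<Theta>) b \<in> carrier ?F"
    if "\<And>i j. i < n \<Longrightarrow> j < n \<Longrightarrow> \<Theta> i j \<in> carrier R" "b \<in> carrier ?F" for \<Theta> b
    using that by (intro mat_map_closed) (auto simp: mat_transpose_def simp del: power_module_simps)
  have \<Phi>a: "mat_map R n (mat_transpose \<Phi>) a \<in> carrier ?F" using \<Phi> a by (rule tc)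
  show ?thesis
  proof (rule dot_form_eqD)
    show "mat_map R n (mat_transpose \<Psi>) (mat_map R n (mat_transpose \<Phi>) a) \<in> carrier ?F"
      using \<Psi> \<Phi>a by (rule tc)
    show "x \<odot>\<^bsub>?F\<^esub> a \<in> carrier ?F" by (rule F.smult_closed[OF x a])
    fix v assume v: "v \<in> carrier ?F"
    have \<Psi>v: "mat_map R n \<Psi> v \<in> carrier ?F" using \<Psi> v by (rule mat_map_closed)
    have "dot_form R n (mat_map R n (mat_transpose \<Psi>) (mat_map R n (mat_transpose \<Phi>) a)) v
        = dot_form R n (mat_map R n (mat_transpose \<Phi>) a) (mat_map R n \<Psi> v)"
      using \<Psi> \<Phi>a v by (rule dot_form_mat_map[symmetric])
    also have "\<dots> = dot_form R n a (mat_map R n \<Phi> (mat_map R n \<Psi> v))"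
      using \<Phi> a \<Psi>v by (rule dot_form_mat_map[symmetric])
    also have "\<dots> = (\<Oplus>i\<in>{..<n}. a i \<otimes> (x \<odot>\<^bsub>?F\<^esub> v) i)"
      unfolding \<Phi>\<Psi>[OF v] by (rule dot_form_apply[OF F.smult_closed[OF x v]])
    also have "\<dots> = (\<Oplus>i\<in>{..<n}. (x \<odot>\<^bsub>?F\<^esub> a) i \<otimes> v i)"
      by (rule finsum_cong') (use a v x in \<open>auto simp: PiE_def Pi_def m_ac\<close>)
    also have "\<dots> = dot_form R n (x \<odot>\<^bsub>?F\<^esub> a) v"
      by (rule dot_form_apply[OF v, symmetric])
    finally show "dot_form R n (mat_map R n (mat_transpose \<Psi>) (mat_map R n (mat_transpose \<Phi>) a)) v
        = dot_form R n (x \<odot>\<^bsub>?F\<^esub> a) v" .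
  qed
qed

text \<open>The functional of \<open>a\<close> kills the image of \<open>\<Phi>\<close> exactly if the functional of \<open>\<Phi>\<^sup>T a\<close> is zero, that is, if
  \<open>\<Phi>\<^sup>T a = 0\<close>.\<close>

lemma dual_coker_eq_kernel_transpose:
  assumes \<Phi>: "\<And>i j. i < n \<Longrightarrow> j < n \<Longrightarrow> \<Phi> i j \<in> carrier R"
  defines "F \<equiv> power_module R n"
  shows "dual_coords R n ` (hom_precomp F (coker_proj F F (mat_map R n \<Phi>)) `
      mod_hom R (coker F F (mat_map R n \<Phi>)) (self_module R))
    = {a \<in> carrier F. mat_map R n (mat_transpose \<Phi>) a = \<zero>\<^bsub>F\<^esub>}"
proof -
  interpret F: module R F unfolding F_def by (rule power_module)
  let ?f = "mat_map R n \<Phi>" and ?t = "mat_map R n (mat_transpose \<Phi>)"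
  have tc: "?t a \<in> carrier F" if "a \<in> carrier F" for a
    using that \<Phi> unfolding F_def by (intro mat_map_closed) (auto simp: mat_transpose_def)
  have "?f \<in> mod_hom R F F"
    unfolding F_def using \<Phi> by (rule mat_map_hom)
  then have "submodule (?f ` carrier F) R F"
    by (rule mod_hom_image_submodule[OF F.module_axioms F.module_axioms])
  then have "hom_precomp F (coker_proj F F ?f) ` mod_hom R (coker F F ?f) (self_module R)
      = {h \<in> mod_hom R F (self_module R). \<forall>u\<in>?f ` carrier F. h u = \<zero>}"
    using F.hom_precomp_quotient_proj_image[OF _ self_module]
    by (simp add: coker_def coker_proj_def)
  also have "\<dots> = dot_form R n ` {a \<in> carrier F. \<forall>v\<in>carrier F. dot_form R n a (?f v) = \<zero>}"
  proof (intro equalityI subsetI)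
    fix h assume "h \<in> {h \<in> mod_hom R F (self_module R). \<forall>u\<in>?f ` carrier F. h u = \<zero>}"
    then show "h \<in> dot_form R n ` {a \<in> carrier F. \<forall>v\<in>carrier F. dot_form R n a (?f v) = \<zero>}"
      using dot_form_dual_coords[of h n] dual_coords_closed[of h n] unfolding F_def
      by (intro image_eqI[of _ _ "dual_coords R n h"]) (auto simp del: power_module_simps)
  qed (use dot_form_hom in \<open>auto simp: F_def simp del: power_module_simps\<close>)
  also have "{a \<in> carrier F. \<forall>v\<in>carrier F. dot_form R n a (?f v) = \<zero>}
      = {a \<in> carrier F. ?t a = \<zero>\<^bsub>F\<^esub>}"
  proof (rule Collect_cong, rule conj_cong[OF refl])
    fix a assume a: "a \<in> carrier F"
    have zero: "dot_form R n \<zero>\<^bsub>F\<^esub> v = \<zero>" if v: "v \<in> carrier F" for v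
    proof -
      have "dot_form R n \<zero>\<^bsub>F\<^esub> v = (\<Oplus>i\<in>{..<n}. \<zero>)"
        using v unfolding F_def dot_form_apply[OF v[unfolded F_def]]
        by (intro finsum_cong') (auto simp: PiE_def Pi_def)
      then show ?thesis by simp
    qed
    have adj: "dot_form R n a (?f v) = dot_form R n (?t a) v" if "v \<in> carrier F" for v
      using \<Phi> a that unfolding F_def by (rule dot_form_mat_map)
    show "(\<forall>v\<in>carrier F. dot_form R n a (?f v) = \<zero>) \<longleftrightarrow> ?t a = \<zero>\<^bsub>F\<^esub>"
    proof
      assume "\<forall>v\<in>carrier F. dot_form R n a (?f v) = \<zero>"
      then show "?t a = \<zero>\<^bsub>F\<^esub>"
        using adj zero
        by (intro dot_form_eqD[OF tc[OF a, unfolded F_def] F.zero_closed[unfolded F_def],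
              folded F_def]) simp
    next
      assume "?t a = \<zero>\<^bsub>F\<^esub>"
      then show "\<forall>v\<in>carrier F. dot_form R n a (?f v) = \<zero>"
        using adj zero by simp
    qed
  qed
  finally have "hom_precomp F (coker_proj F F ?f) ` mod_hom R (coker F F ?f) (self_module R)
      = dot_form R n ` {a \<in> carrier F. ?t a = \<zero>\<^bsub>F\<^esub>}" .
  moreover have "dual_coords R n ` dot_form R n ` K = K" if "K \<subseteq> carrier F" for K
  proof -
    have "dual_coords R n ` dot_form R n ` K = (\<lambda>a. a) ` K"
      unfolding image_image using that dual_coords_dot_form unfolding F_def
      by (intro image_cong refl) blast
    then show ?thesis by simp
  qed
  ultimately show ?thesis by auto
qed

end

section \<open>Power series over a Noetherian ring\<close>

text \<open>The annihilators of the powers of \<open>g\<close> form an ascending chain of ideals, so one of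
  them contains all the others.\<close>

lemma (in noetherian_ring) annihilators_of_powers_stabilize:
  assumes "cring R" and g: "g \<in> carrier R"
  obtains N :: nat where
    "\<And>m s. s \<in> carrier R \<Longrightarrow> g [^] (m::nat) \<otimes> s = \<zero> \<Longrightarrow> g [^] N \<otimes> s = \<zero>"
proof -
  interpret cring R by (rule assms(1))
  define J where "J m = {s \<in> carrier R. g [^] (m::nat) \<otimes> s = \<zero>}" for m
  have gm: "g [^] (m::nat) \<in> carrier R" for m using g by simp
  have ideal: "ideal (J m) R" for m
  proof (rule idealI[OF ring_axioms])
    show "subgroup (J m) (add_monoid R)"
    proof (rule add.subgroupI)
      have "\<zero> \<in> J m" using gm by (simp add: J_def)
      then show "J m \<noteq> {}" by blast
    qed (use gm in \<open>auto simp: J_def r_distr r_minus\<close>)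
  next
    fix s r assume s: "s \<in> J m" and r: "r \<in> carrier R"
    then have "g [^] m \<otimes> (r \<otimes> s) = r \<otimes> (g [^] m \<otimes> s)"
      using gm by (intro m_lcomm) (auto simp: J_def)
    then show rs: "r \<otimes> s \<in> J m" using s r by (simp add: J_def)
    show "s \<otimes> r \<in> J m" using rs s r m_comm[of s r] by (simp add: J_def)
  qed
  have step: "J m \<subseteq> J (m + d)" for m d
  proof
    fix s assume "s \<in> J m"
    then have s: "s \<in> carrier R" "g [^] m \<otimes> s = \<zero>" by (auto simp: J_def)
    have "g [^] (m + d) \<otimes> s = g [^] d \<otimes> (g [^] m \<otimes> s)"
      using s(1) g gm by (simp add: nat_pow_mult[symmetric] m_ac)
    then show "s \<in> J (m + d)" using s gm by (simp add: J_def)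
  qed
  have "subset.chain {I. ideal I R} (range J)"
    unfolding subset_chain_def
  proof (intro conjI ballI)
    fix X Y assume "X \<in> range J" "Y \<in> range J"
    then obtain m k where "X = J m" "Y = J k" by blast
    then show "X \<subseteq> Y \<or> Y \<subseteq> X" using step le_Suc_ex nat_le_linear by metis
  qed (use ideal in auto)
  then have "\<Union>(range J) \<in> range J" by (intro ideal_chain_is_trivial) auto
  then obtain N where "\<Union>(range J) = J N" by blast
  then have "J m \<subseteq> J N" for m by blast
  then show ?thesis using that[of N] unfolding J_def by blast
qed

context cring
begin

lemma ps_z_mult:
  assumes p: "p \<in> carrier (ps_ring R)"
  shows "(ps_z R \<otimes>\<^bsub>ps_ring R\<^esub> p) k = (if k = 0 then \<zero> else p (k - 1))"
proof -
  have pk: "p i \<in> carrier R" for i using p by auto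
  have "(ps_z R \<otimes>\<^bsub>ps_ring R\<^esub> p) k = (\<Oplus>i\<in>{..k}. p (k - i) \<otimes> (if 1 = i then \<one> else \<zero>))"
    unfolding ps_simps by (rule finsum_cong') (use pk in \<open>auto simp: ps_z_def\<close>)
  also have "\<dots> = (if k = 0 then \<zero> else p (k - 1))"
    by (subst finsum_delta) (use pk in auto)
  finally show ?thesis .
qed

lemma ps_const_mult:
  assumes p: "p \<in> carrier (ps_ring R)" and c: "c \<in> carrier R"
  shows "(ps_const R c \<otimes>\<^bsub>ps_ring R\<^esub> p) k = c \<otimes> p k"
proof -
  have pk: "p i \<in> carrier R" for i using p by auto
  have "(ps_const R c \<otimes>\<^bsub>ps_ring R\<^esub> p) k = (\<Oplus>i\<in>{..k}. (c \<otimes> p (k - i)) \<otimes> (if 0 = i then \<one> else \<zero>))"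
    unfolding ps_simps by (rule finsum_cong') (use pk c in \<open>auto simp: ps_const_def\<close>)
  also have "\<dots> = c \<otimes> p k"
    by (subst finsum_delta) (use pk c in auto)
  finally show ?thesis .
qed

lemma ps_z_closed: "ps_z R \<in> carrier (ps_ring R)"
  by (auto simp: ps_z_def)

lemma ps_const_closed: "c \<in> carrier R \<Longrightarrow> ps_const R c \<in> carrier (ps_ring R)"
  by (auto simp: ps_const_def)

text \<open>Comparing coefficients in \<open>(z\<^sup>2 + g) p = 0\<close> gives \<open>g p\<^sub>0 = g p\<^sub>1 = 0\<close> and \<open>p\<^sub>k = - g p\<^sub>k\<^sub>+\<^sub>2\<close>. The former
  facts propagate upwards to show that \<open>p\<^sub>k\<close> is annihilated by \<open>g\<^sup>k\<^sup>+\<^sup>1\<close>, hence by a fixed power \<open>g\<^sup>N\<close>. The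
  latter one, iterated \<open>N\<close> times, writes \<open>p\<^sub>k\<close> as plus or minus \<open>g\<^sup>N p\<^sub>k\<^sub>+\<^sub>2\<^sub>N\<close>, which is then zero.\<close>

lemma ps_z_sq_plus_const_nonzerodivisor:
  assumes "noetherian_ring R" and g: "g \<in> carrier R"
    and p: "p \<in> carrier (ps_ring R)"
    and eq: "(ps_z R [^]\<^bsub>ps_ring R\<^esub> (2::nat) \<oplus>\<^bsub>ps_ring R\<^esub> ps_const R g) \<otimes>\<^bsub>ps_ring R\<^esub> p
      = \<zero>\<^bsub>ps_ring R\<^esub>"
  shows "p = \<zero>\<^bsub>ps_ring R\<^esub>"
proof -
  interpret noetherian_ring R by (rule assms(1))
  interpret P: cring "ps_ring R" by (rule ps_cring)
  have pk: "p k \<in> carrier R" for k using p by auto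
  have gm: "g [^] (m::nat) \<in> carrier R" for m using g by simp
  let ?z = "ps_z R"
  have "(?z [^]\<^bsub>ps_ring R\<^esub> (2::nat) \<oplus>\<^bsub>ps_ring R\<^esub> ps_const R g) \<otimes>\<^bsub>ps_ring R\<^esub> p
      = ?z \<otimes>\<^bsub>ps_ring R\<^esub> (?z \<otimes>\<^bsub>ps_ring R\<^esub> p) \<oplus>\<^bsub>ps_ring R\<^esub> ps_const R g \<otimes>\<^bsub>ps_ring R\<^esub> p"
    using ps_z_closed ps_const_closed[OF g] p
    by (simp add: P.l_distr P.m_assoc numeral_2_eq_2 del: ps_simps)
  then have coeff: "(if k < 2 then \<zero> else p (k - Suc (Suc 0))) \<oplus> g \<otimes> p k = \<zero>" for k
    using fun_cong[OF eq, of k] ps_z_closed p P.m_closed[OF ps_z_closed p]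
    by (auto simp: ps_z_mult ps_const_mult g simp del: ps_simps(1,2) split: if_splits)
  have low: "g \<otimes> p k = \<zero>" if "k < 2" for k
    using coeff[of k] that pk g by simp
  have shift: "p k = \<ominus> (g \<otimes> p (k + 2))" for k
    using coeff[of "k + 2"] pk g by (simp add: sum_zero_eq_neg)
  have kill: "g [^] Suc k \<otimes> p k = \<zero>" for k
  proof (induction k rule: less_induct)
    case (less k)
    show ?case
    proof (cases "k < 2")
      case True
      then show ?thesis using low[OF True] gm pk g by (simp add: m_assoc)
    next
      case False
      then obtain j where j: "k = j + 2" using le_Suc_ex by (metis add.commute not_less)
      have "g [^] Suc k \<otimes> p k = g [^] (j + 2) \<otimes> (g \<otimes> p k)"
        using gm pk g j by (simp add: m_assoc)
      also have "g \<otimes> p k = \<ominus> p j" using shift[of j] j pk g by simp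
      also have "g [^] (j + 2) \<otimes> \<ominus> p j = \<ominus> (g \<otimes> (g [^] Suc j \<otimes> p j))"
        using gm pk g by (simp add: r_minus m_ac)
      finally show ?thesis using less[of j] j g by simp
    qed
  qed
  obtain N :: nat where N: "\<And>m s. s \<in> carrier R \<Longrightarrow> g [^] (m::nat) \<otimes> s = \<zero> \<Longrightarrow> g [^] N \<otimes> s = \<zero>"
    using annihilators_of_powers_stabilize[OF is_cring g] by blast
  have "g [^] N \<otimes> p k = \<zero>" for k
    by (rule N[OF pk kill])
  moreover have "p k = \<zero>" if "g [^] m \<otimes> p (k + 2 * m) = \<zero>" for k and m :: nat
    using that
  proof (induction m arbitrary: k)
    case 0
    then show ?case using pk by simp
  next
    case (Suc m)
    have "g [^] m \<otimes> p (k + 2 * m) = g [^] m \<otimes> \<ominus> (g \<otimes> p (k + 2 * Suc m))"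
      using shift[of "k + 2 * m"] by (simp add: add.commute add.left_commute)
    also have "\<dots> = \<ominus> (g [^] Suc m \<otimes> p (k + 2 * Suc m))"
      using gm pk g by (simp add: r_minus m_assoc)
    finally show ?case using Suc by simp
  qed
  ultimately have "p k = \<zero>" for k by blast
  then show ?thesis by (simp add: fun_eq_iff)
qed

end

section \<open>Exactness modulo a nonzerodivisor\<close>

context cring
begin

definition vec_bar :: "'a set \<Rightarrow> nat \<Rightarrow> (nat \<Rightarrow> 'a) \<Rightarrow> (nat \<Rightarrow> 'a set)" where
  "vec_bar I n v = (\<lambda>i\<in>{..<n}. I +> v i)"

lemma vec_bar_closed:
  assumes "ideal I R" "v \<in> carrier (power_module R n)"
  shows "vec_bar I n v \<in> carrier (power_module (R Quot I) n)"
proof -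
  interpret ideal I R by (rule assms(1))
  show ?thesis
    using assms(2) ring_hom_closed[OF rcos_ring_hom] by (auto simp: vec_bar_def)
qed

lemma vec_bar_surj:
  assumes "ideal I R" "w \<in> carrier (power_module (R Quot I) n)"
  obtains v where "v \<in> carrier (power_module R n)" "w = vec_bar I n v"
proof -
  have "\<exists>r\<in>carrier R. w i = I +> r" if "i < n" for i
    using assms(2) that by (auto simp: FactRing_def A_RCOSETS_def')
  then obtain v where v: "\<And>i. i < n \<Longrightarrow> v i \<in> carrier R \<and> w i = I +> v i" by metis
  show ?thesis
  proof (rule that[of "restrict v {..<n}"])
    show "restrict v {..<n} \<in> carrier (power_module R n)" using v by auto
    show "w = vec_bar I n (restrict v {..<n})"
      using assms(2) v
      by (intro extensionalityI[of w "{..<n}"]) (auto simp: vec_bar_def PiE_def)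
  qed
qed

lemma mat_map_bar:
  assumes "ideal I R" and \<Phi>: "\<And>i j. i < n \<Longrightarrow> j < n \<Longrightarrow> \<Phi> i j \<in> carrier R"
    and v: "v \<in> carrier (power_module R n)"
  shows "mat_map (R Quot I) n (mat_bar R I \<Phi>) (vec_bar I n v) = vec_bar I n (mat_map R n \<Phi> v)"
proof -
  interpret I: ideal I R by (rule assms(1))
  interpret h: ring_hom_cring R "R Quot I" "(+>) I"
    by (rule I.rcos_ring_hom_cring[OF is_cring])
  note vb = vec_bar_closed[OF assms(1) v]
  have vi: "v i \<in> carrier R" if "i < n" for i using v that by auto
  have "(\<Oplus>\<^bsub>R Quot I\<^esub>j\<in>{..<n}. mat_bar R I \<Phi> i j \<otimes>\<^bsub>R Quot I\<^esub> vec_bar I n v j)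
      = I +> (\<Oplus>j\<in>{..<n}. \<Phi> i j \<otimes> v j)" if i: "i < n" for i
  proof -
    have "I +> (\<Oplus>j\<in>{..<n}. \<Phi> i j \<otimes> v j)
        = (\<Oplus>\<^bsub>R Quot I\<^esub>j\<in>{..<n}. ((+>) I \<circ> (\<lambda>j. \<Phi> i j \<otimes> v j)) j)"
      by (rule h.hom_finsum) (use \<Phi> vi i in auto)
    also have "\<dots> = (\<Oplus>\<^bsub>R Quot I\<^esub>j\<in>{..<n}. mat_bar R I \<Phi> i j \<otimes>\<^bsub>R Quot I\<^esub> vec_bar I n v j)"
      by (rule h.S.finsum_cong') (use \<Phi> vi i in \<open>auto simp: mat_bar_def vec_bar_def\<close>)
    finally show ?thesis by simp
  qed
  then show ?thesis
    using vb v by (simp add: mat_map_def vec_bar_def cong: restrict_cong)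
qed

lemma vec_bar_eq_zero_iff:
  assumes x: "x \<in> carrier R" and v: "v \<in> carrier (power_module R n)"
  shows "vec_bar (PIdl x) n v = \<zero>\<^bsub>power_module (R Quot (PIdl x)) n\<^esub> \<longleftrightarrow>
    (\<exists>b\<in>carrier (power_module R n). v = x \<odot>\<^bsub>power_module R n\<^esub> b)" (is "?l \<longleftrightarrow> ?r")
proof
  interpret I: ideal "PIdl x" R by (rule cgenideal_ideal[OF x])
  have vi: "v i \<in> carrier R" if "i < n" for i using v that by auto
  have zero: "\<zero>\<^bsub>R Quot (PIdl x)\<^esub> = PIdl x" by (simp add: FactRing_def)
  show ?r if ?l
  proof -
    have "\<exists>c\<in>carrier R. v i = x \<otimes> c" if i: "i < n" for i
    proof -
      have "PIdl x +> v i = PIdl x"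
        using fun_cong[OF \<open>?l\<close>, of i] i by (simp add: vec_bar_def zero)
      then have "v i \<in> PIdl x" by (rule I.rcos_const_imp_mem[OF vi[OF i]])
      then obtain c where "c \<in> carrier R" "v i = c \<otimes> x" unfolding cgenideal_def by blast
      then show ?thesis using m_comm[OF _ x] by (intro bexI[of _ c]) simp_all
    qed
    then obtain b where b: "\<And>i. i < n \<Longrightarrow> b i \<in> carrier R \<and> v i = x \<otimes> b i" by metis
    show ?r
    proof
      show "restrict b {..<n} \<in> carrier (power_module R n)" using b by auto
      show "v = x \<odot>\<^bsub>power_module R n\<^esub> restrict b {..<n}"
        using v b by (intro extensionalityI[of v "{..<n}"]) (auto simp: PiE_def)
    qed
  qed
  show ?l if ?r
  proof -
    from that obtain b where b: "b \<in> carrier (power_module R n)"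
      and vb: "v = x \<odot>\<^bsub>power_module R n\<^esub> b" by blast
    have "v i \<in> PIdl x" if i: "i < n" for i
    proof -
      have "b i \<in> carrier R" using b i by auto
      moreover have "v i = b i \<otimes> x" using vb i m_comm[OF x calculation] by simp
      ultimately show ?thesis unfolding cgenideal_def by blast
    qed
    then show ?l
      unfolding vec_bar_def power_module_simps zero
      by (intro restrict_ext a_rcos_zero[OF I.ideal_axioms]) blast
  qed
qed

text \<open>Lift \<open>a\<close> to a vector \<open>v\<close> over the ring itself. Its image under \<open>\<Phi>\<close> vanishes modulo \<open>x\<close> exactly if
  \<open>\<Phi> v = x b\<close> for some \<open>b\<close>. Then \<open>x v = \<Psi> \<Phi> v = x \<Psi> b\<close>, so \<open>v = \<Psi> b\<close> by cancelling \<open>x\<close>; conversely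
  \<open>\<Phi> \<Psi> b = x b\<close>.\<close>

lemma factorization_exact_mod_nonzerodivisor:
  assumes \<Phi>: "\<And>i j. i < n \<Longrightarrow> j < n \<Longrightarrow> \<Phi> i j \<in> carrier R"
    and \<Psi>: "\<And>i j. i < n \<Longrightarrow> j < n \<Longrightarrow> \<Psi> i j \<in> carrier R"
    and x: "x \<in> carrier R"
    and nzd: "\<And>r. r \<in> carrier R \<Longrightarrow> x \<otimes> r = \<zero> \<Longrightarrow> r = \<zero>"
    and \<Phi>\<Psi>: "\<And>v. v \<in> carrier (power_module R n) \<Longrightarrow>
      mat_map R n \<Phi> (mat_map R n \<Psi> v) = x \<odot>\<^bsub>power_module R n\<^esub> v"
    and \<Psi>\<Phi>: "\<And>v. v \<in> carrier (power_module R n) \<Longrightarrow>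
      mat_map R n \<Psi> (mat_map R n \<Phi> v) = x \<odot>\<^bsub>power_module R n\<^esub> v"
  defines "I \<equiv> PIdl x"
  shows "{a \<in> carrier (power_module (R Quot I) n).
      mat_map (R Quot I) n (mat_bar R I \<Phi>) a = \<zero>\<^bsub>power_module (R Quot I) n\<^esub>}
    = mat_map (R Quot I) n (mat_bar R I \<Psi>) ` carrier (power_module (R Quot I) n)"
proof -
  let ?F = "power_module R n" and ?Q = "power_module (R Quot I) n"
  let ?f = "mat_map R n \<Phi>" and ?g = "mat_map R n \<Psi>"
  interpret F: module R ?F by (rule power_module)
  have I: "ideal I R" unfolding I_def by (rule cgenideal_ideal[OF x])
  have fc: "?f v \<in> carrier ?F" if "v \<in> carrier ?F" for v using \<Phi> that by (rule mat_map_closed)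
  have gc: "?g v \<in> carrier ?F" if "v \<in> carrier ?F" for v using \<Psi> that by (rule mat_map_closed)
  have fbar: "mat_map (R Quot I) n (mat_bar R I \<Phi>) (vec_bar I n v) = vec_bar I n (?f v)"
    if "v \<in> carrier ?F" for v
    using I \<Phi> that by (rule mat_map_bar)
  have gbar: "mat_map (R Quot I) n (mat_bar R I \<Psi>) (vec_bar I n v) = vec_bar I n (?g v)"
    if "v \<in> carrier ?F" for v
    using I \<Psi> that by (rule mat_map_bar)
  have cancel: "v = w"
    if v: "v \<in> carrier ?F" and w: "w \<in> carrier ?F" and eq: "x \<odot>\<^bsub>?F\<^esub> v = x \<odot>\<^bsub>?F\<^esub> w" for v w
  proof (rule power_module_eqI[OF v w])
    fix i assume i: "i < n"
    have vw: "v i \<in> carrier R" "w i \<in> carrier R" using v w i by auto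
    have "x \<otimes> v i = x \<otimes> w i" using fun_cong[OF eq, of i] i by simp
    then have "x \<otimes> (v i \<ominus> w i) = \<zero>" using vw x by (simp add: minus_eq r_distr r_minus r_neg)
    then show "v i = w i" using nzd[of "v i \<ominus> w i"] vw by (simp add: minus_closed r_right_minus_eq)
  qed
  have "vec_bar I n (?f v) = \<zero>\<^bsub>?Q\<^esub> \<longleftrightarrow> (\<exists>b\<in>carrier ?F. v = ?g b)" if v: "v \<in> carrier ?F" for v
  proof -
    have "vec_bar I n (?f v) = \<zero>\<^bsub>?Q\<^esub> \<longleftrightarrow> (\<exists>b\<in>carrier ?F. ?f v = x \<odot>\<^bsub>?F\<^esub> b)"
      unfolding I_def by (rule vec_bar_eq_zero_iff[OF x fc[OF v]])
    also have "\<dots> \<longleftrightarrow> (\<exists>b\<in>carrier ?F. v = ?g b)"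
    proof (rule bex_cong[OF refl])
      fix b assume b: "b \<in> carrier ?F"
      have "?g (x \<odot>\<^bsub>?F\<^esub> b) = x \<odot>\<^bsub>?F\<^esub> ?g b"
      proof -
        have "?g \<in> mod_hom R ?F ?F" using \<Psi> by (rule mat_map_hom)
        then show ?thesis using x b unfolding mod_hom_def by blast
      qed
      then show "?f v = x \<odot>\<^bsub>?F\<^esub> b \<longleftrightarrow> v = ?g b"
        using cancel[OF v gc[OF b]] \<Psi>\<Phi>[OF v] \<Phi>\<Psi>[OF b] by metis
    qed
    finally show ?thesis .
  qed
  then have kernel: "mat_map (R Quot I) n (mat_bar R I \<Phi>) (vec_bar I n v) = \<zero>\<^bsub>?Q\<^esub>
      \<longleftrightarrow> (\<exists>b\<in>carrier ?F. v = ?g b)" if "v \<in> carrier ?F" for v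
    using fbar that by simp
  show ?thesis
  proof (intro equalityI subsetI)
    fix a assume "a \<in> {a \<in> carrier ?Q. mat_map (R Quot I) n (mat_bar R I \<Phi>) a = \<zero>\<^bsub>?Q\<^esub>}"
    then have a: "a \<in> carrier ?Q" and a0: "mat_map (R Quot I) n (mat_bar R I \<Phi>) a = \<zero>\<^bsub>?Q\<^esub>"
      by (simp_all only: mem_Collect_eq)
    obtain v where v: "v \<in> carrier ?F" "a = vec_bar I n v" by (rule vec_bar_surj[OF I a])
    obtain b where b: "b \<in> carrier ?F" "v = ?g b"
      using a0 kernel[OF v(1)] unfolding v(2) by blast
    have "a = mat_map (R Quot I) n (mat_bar R I \<Psi>) (vec_bar I n b)"
      unfolding gbar[OF b(1)] v(2) b(2) ..
    then show "a \<in> mat_map (R Quot I) n (mat_bar R I \<Psi>) ` carrier ?Q"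
      using vec_bar_closed[OF I b(1)] by (rule image_eqI)
  next
    fix a assume "a \<in> mat_map (R Quot I) n (mat_bar R I \<Psi>) ` carrier ?Q"
    then obtain w where w: "w \<in> carrier ?Q" "a = mat_map (R Quot I) n (mat_bar R I \<Psi>) w" by blast
    obtain b where b: "b \<in> carrier ?F" "w = vec_bar I n b" by (rule vec_bar_surj[OF I w(1)])
    have a: "a = vec_bar I n (?g b)" unfolding w(2) b(2) by (rule gbar[OF b(1)])
    then show "a \<in> {a \<in> carrier ?Q. mat_map (R Quot I) n (mat_bar R I \<Phi>) a = \<zero>\<^bsub>?Q\<^esub>}"
      unfolding mem_Collect_eq a
      by (intro conjI vec_bar_closed[OF I gc[OF b(1)]]
          kernel[OF gc[OF b(1)], THEN iffD2] bexI[OF refl b(1)])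
  qed
qed

end

section \<open>The dual of the cokernel\<close>

theorem theorem4p6:
  fixes S :: "('a, 'b) ring_scheme" and g :: 'a and n :: nat
    and P :: "(nat \<Rightarrow> 'a) ring" and z x :: "nat \<Rightarrow> 'a" and I :: "(nat \<Rightarrow> 'a) set"
    and R :: "(nat \<Rightarrow> 'a) set ring"
    and \<phi> :: "(nat \<Rightarrow> 'a) sqmat"
    and A B :: "(nat \<Rightarrow> 'a) sqmat"
    and Rn :: "((nat \<Rightarrow> 'a) set, nat \<Rightarrow> (nat \<Rightarrow> 'a) set) module"
    and \<alpha> :: "(nat \<Rightarrow> (nat \<Rightarrow> 'a) set) \<Rightarrow> (nat \<Rightarrow> (nat \<Rightarrow> 'a) set)"
    and M :: "((nat \<Rightarrow> 'a) set, (nat \<Rightarrow> (nat \<Rightarrow> 'a) set) set) module"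
  assumes "local_ring S" and "noetherian_ring S" and "g \<in> carrier S"
    and "P = ps_ring S" and "z = ps_z S"
    and "x = z [^]\<^bsub>P\<^esub> (2::nat) \<oplus>\<^bsub>P\<^esub> ps_const S g"
    and "I = PIdl\<^bsub>P\<^esub> x" and "R = P Quot I"
    and "\<And>i j. i < n \<Longrightarrow> j < n \<Longrightarrow> \<phi> i j \<in> ps_const S ` carrier S"
    and "A = mat_diff P (mat_scale P z (mat_id P)) \<phi>"
    and "B = mat_add P (mat_scale P z (mat_id P)) \<phi>"
    and "matrix_factorization P x (power_module P n) (power_module P n)
           (mat_map P n A) (mat_map P n B)"
    and "Rn = power_module R n"
    and "\<alpha> = mat_map R n (mat_bar P I A)"
    and "M = coker Rn Rn \<alpha>"
  shows "dual_coords R n ` (hom_precomp Rn (coker_proj Rn Rn \<alpha>) ` mod_hom R M (self_module R))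
       = mat_map R n (mat_bar P I (mat_add P (mat_scale P z (mat_id P)) (mat_transpose \<phi>)))
           ` carrier Rn"
proof -
  interpret S: cring S using assms(1) by (simp add: local_ring_def)
  interpret P: cring P unfolding assms(4) by (rule S.ps_cring)
  have z: "z \<in> carrier P" unfolding assms(4,5) by (rule S.ps_z_closed)
  have x: "x \<in> carrier P"
    unfolding assms(6) using S.ps_const_closed[OF assms(3), folded assms(4)]
    by (rule P.a_closed[OF P.nat_pow_closed[OF z]])
  have \<phi>: "\<phi> i j \<in> carrier P" if "i < n" "j < n" for i j
  proof -
    obtain s where "s \<in> carrier S" "\<phi> i j = ps_const S s" using assms(9)[OF \<open>i < n\<close> \<open>j < n\<close>] by (rule imageE)
    then show ?thesis using S.ps_const_closed by (simp only: assms(4))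
  qed
  have A: "A i j \<in> carrier P" and B: "B i j \<in> carrier P" if "i < n" "j < n" for i j
    using \<phi>[OF that] z
    by (simp_all add: assms(10,11) mat_diff_def mat_add_def mat_scale_def mat_id_def)
  have At: "mat_transpose A i j \<in> carrier P" and Bt: "mat_transpose B i j \<in> carrier P"
    if "i < n" "j < n" for i j
    using A B that by (simp_all add: mat_transpose_def)
  have AB: "mat_map P n A (mat_map P n B v) = x \<odot>\<^bsub>power_module P n\<^esub> v"
    and BA: "mat_map P n B (mat_map P n A v) = x \<odot>\<^bsub>power_module P n\<^esub> v"
    if "v \<in> carrier (power_module P n)" for v
    using assms(12) that by (simp_all add: matrix_factorization_def del: power_module_simps(1,2,3))
  have nzd: "r = \<zero>\<^bsub>P\<^esub>" if "r \<in> carrier P" "x \<otimes>\<^bsub>P\<^esub> r = \<zero>\<^bsub>P\<^esub>" for r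
    using that unfolding assms(4-6) by (rule S.ps_z_sq_plus_const_nonzerodivisor[OF assms(2,3)])
  have I: "ideal I P" unfolding assms(7) by (rule P.cgenideal_ideal[OF x])
  interpret R: cring R
    unfolding assms(8) by (rule ideal.quotient_is_cring[OF I P.is_cring])
  have bar: "mat_bar P I A i j \<in> carrier R" if "i < n" "j < n" for i j
    using ring_hom_closed[OF ideal.rcos_ring_hom[OF I] A[OF that]]
    by (simp add: mat_bar_def assms(8))
  have "dual_coords R n ` (hom_precomp Rn (coker_proj Rn Rn \<alpha>) ` mod_hom R M (self_module R))
      = {a \<in> carrier Rn. mat_map R n (mat_transpose (mat_bar P I A)) a = \<zero>\<^bsub>Rn\<^esub>}"
    unfolding assms(13-15) using bar by (rule R.dual_coker_eq_kernel_transpose)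
  also have "mat_transpose (mat_bar P I A) = mat_bar P I (mat_transpose A)"
    by (simp add: mat_transpose_def mat_bar_def)
  also have "{a \<in> carrier Rn. mat_map R n (mat_bar P I (mat_transpose A)) a = \<zero>\<^bsub>Rn\<^esub>}
      = mat_map R n (mat_bar P I (mat_transpose B)) ` carrier Rn"
    unfolding assms(13,8,7)
  proof (rule P.factorization_exact_mod_nonzerodivisor)
    show "mat_transpose A i j \<in> carrier P" "mat_transpose B i j \<in> carrier P"
      if "i < n" "j < n" for i j
      using At Bt that by blast+
    show "x \<in> carrier P" by (rule x)
    show "r = \<zero>\<^bsub>P\<^esub>" if "r \<in> carrier P" "x \<otimes>\<^bsub>P\<^esub> r = \<zero>\<^bsub>P\<^esub>" for r
      using that by (rule nzd)
    fix v assume v: "v \<in> carrier (power_module P n)"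
    show "mat_map P n (mat_transpose A) (mat_map P n (mat_transpose B) v) = x \<odot>\<^bsub>power_module P n\<^esub> v"
      using B A x BA v by (rule P.transpose_factorization)
    show "mat_map P n (mat_transpose B) (mat_map P n (mat_transpose A) v) = x \<odot>\<^bsub>power_module P n\<^esub> v"
      using A B x AB v by (rule P.transpose_factorization)
  qed
  \<comment> \<open>The matrix \<open>z Id\<close> is symmetric.\<close>
  also have "mat_transpose B = mat_add P (mat_scale P z (mat_id P)) (mat_transpose \<phi>)"
    by (auto simp: assms(11) mat_transpose_def mat_add_def mat_scale_def mat_id_def fun_eq_iff)
  finally show ?thesis .
qed

end
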